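(* Let $(\mathfrak X,+,\mathcal A)$ be a measurable Abelian semigroup with zero element. Let $d,k\in\mathbb N$, $p_{j,r}\in\mathbb R$ for $j\in\{1,\dots,k\}$ and $r\in\{1,\dots,d\}$, and $(\lambda_1,\dots,\lambda_d)\in(0,\infty)^d$. For $r\in\{1,\dots,d\}$ let $U_r$ be a probability measure on $(\mathfrak X,\mathcal A)$ and $W_r=U_r-\delta_0$. Set $R_j=\sum_{r=1}^d p_{j,r}W_r$ for $j\in\{1,\dots,k\}$ and $G=\exp\bigl(\sum_{r=1}^d\lambda_rW_r\bigr)$. Then $$\Bigl\|\Bigl(\prod_{j=1}^k R_j\Bigr)G\Bigr\|\le\Biggl(\frac1{k!}\sum_{r\in\{1,\dots,d\}^k}\Bigl(\sum_{\ell\in S_k}\prod_{j=1}^k\frac{p_{j,r_{\ell(j)}}}{\sqrt{\lambda_{r_{\ell(j)}}}}\Bigr)^2\Biggr)^{1/2}\le\sqrt{k!}\,\prod_{j=1}^k\Bigl(\sum_{r=1}^d\frac{p_{j,r}^2}{\lambda_r}\Bigr)^{1/2},$$ where $S_k$ is the set of all permutations of $\{1,\dots,k\}$ and $r=(r_1,\dots,r_k)$.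
   Context: A measurable Abelian semigroup with zero element $(\mathfrak X,+,\mathcal A)$ is a commutative semigroup $(\mathfrak X,+)$ with identity element $0$ and a $\sigma$-algebra $\mathcal A$ on $\mathfrak X$ such that $(x,y)\mapsto x+y$ is measurable from $(\mathfrak X\times\mathfrak X,\mathcal A\otimes\mathcal A)$ to $(\mathfrak X,\mathcal A)$. $\delta_x$ is the Dirac measure at $x\in\mathfrak X$. Products and powers of finite signed measures on $(\mathfrak X,\mathcal A)$ are convolutions, $VW(A)=\int_{\mathfrak X}V(\{y\in\mathfrak X: x+y\in A\})\,dW(x)$, with empty products and zeroth powers equal to $\delta_0$; $\exp(V)=\sum_{m=0}^\infty V^m/m!$. $\|V\|=V^+(\mathfrak X)+V^-(\mathfrak X)$ is the total variation norm, where $V=V^+-V^-$ is the Hahn-Jordan decomposition. *)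

theory Defs
  imports "HOL-Probability.Probability" "HOL-Combinatorics.Permutations"
begin

(* Only the measurable-space part of M (its space and its sigma-algebra) is ever used. *)
locale measurable_abelian_semigroup =
  fixes M :: "'a::comm_monoid_add measure"
  assumes space_UNIV: "space M = UNIV"
    and measurable_add: "(\<lambda>(x, y). x + y) \<in> measurable (M \<Otimes>\<^sub>M M) M"

text \<open>
  A finite signed measure on the measurable space M is represented by its real-valued set function.
  Only its values on sets M are meaningful: the Jordan decomposition, and hence the
  integral and the norm below, do not depend on the values elsewhere.
\<close>

definition is_jordan_decomposition ::
    "'a measure \<Rightarrow> ('a set \<Rightarrow> real) \<Rightarrow> 'a measure \<Rightarrow> 'a measure \<Rightarrow> bool" where
  "is_jordan_decomposition M V P N \<longleftrightarrow>
     finite_measure P \<and> finite_measure N \<and> sets P = sets M \<and> sets N = sets M \<and>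
     (\<forall>A\<in>sets M. V A = measure P A - measure N A) \<and>
     (\<exists>H\<in>sets M. measure P (space M - H) = 0 \<and> measure N H = 0)"

definition jordan_pos :: "'a measure \<Rightarrow> ('a set \<Rightarrow> real) \<Rightarrow> 'a measure" where
  "jordan_pos M V = (THE P. \<exists>N. is_jordan_decomposition M V P N)"

definition jordan_neg :: "'a measure \<Rightarrow> ('a set \<Rightarrow> real) \<Rightarrow> 'a measure" where
  "jordan_neg M V = (THE N. \<exists>P. is_jordan_decomposition M V P N)"

definition tv_norm :: "'a measure \<Rightarrow> ('a set \<Rightarrow> real) \<Rightarrow> real" where
  "tv_norm M V = measure (jordan_pos M V) (space M) + measure (jordan_neg M V) (space M)"

definition signed_integral :: "'a measure \<Rightarrow> ('a set \<Rightarrow> real) \<Rightarrow> ('a \<Rightarrow> real) \<Rightarrow> real" where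
  "signed_integral M W f = (LINT x|jordan_pos M W. f x) - (LINT x|jordan_neg M W. f x)"

definition dirac :: "'a measure \<Rightarrow> 'a \<Rightarrow> 'a set \<Rightarrow> real" where
  "dirac M x A = measure (return M x) A"

definition conv ::
    "'a::comm_monoid_add measure \<Rightarrow> ('a set \<Rightarrow> real) \<Rightarrow> ('a set \<Rightarrow> real) \<Rightarrow> 'a set \<Rightarrow> real" where
  "conv M V W A = signed_integral M W (\<lambda>x. V {y \<in> space M. x + y \<in> A})"

primrec conv_prod ::
    "'a::comm_monoid_add measure \<Rightarrow> (nat \<Rightarrow> 'a set \<Rightarrow> real) \<Rightarrow> nat \<Rightarrow> 'a set \<Rightarrow> real" where
  "conv_prod M V 0 = dirac M 0"
| "conv_prod M V (Suc n) = conv M (conv_prod M V n) (V (Suc n))"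

definition conv_power ::
    "'a::comm_monoid_add measure \<Rightarrow> ('a set \<Rightarrow> real) \<Rightarrow> nat \<Rightarrow> 'a set \<Rightarrow> real" where
  "conv_power M V m = conv_prod M (\<lambda>_. V) m"

(* The exponential series converges in total variation, so its sum may be taken setwise. *)
definition conv_exp ::
    "'a::comm_monoid_add measure \<Rightarrow> ('a set \<Rightarrow> real) \<Rightarrow> 'a set \<Rightarrow> real" where
  "conv_exp M V A = (\<Sum>m. conv_power M V m A / fact m)"

text \<open>The Jordan decomposition is unique, and it exists for differences of finite measures.\<close>

lemma is_jordan_decomposition_uminus:
  "is_jordan_decomposition M V P N \<Longrightarrow> is_jordan_decomposition M (\<lambda>A. - V A) N P"
  unfolding is_jordan_decomposition_def
proof (elim conjE bexE, intro conjI)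
  fix H assume H: "H \<in> sets M" "measure P (space M - H) = 0" "measure N H = 0"
  show "\<exists>H\<in>sets M. measure N (space M - H) = 0 \<and> measure P H = 0"
  proof (intro bexI[of _ "space M - H"] conjI)
    have "space M - (space M - H) = H" using sets.sets_into_space[OF H(1)] by blast
    then show "measure N (space M - (space M - H)) = 0" using H by simp
  qed (use H in auto)
qed auto

lemma jordan_pos_unique:
  assumes "is_jordan_decomposition M V P N" "is_jordan_decomposition M V P' N'"
  shows "P = P'"
proof -
  have key: "measure P A = V (A \<inter> H \<inter> H')"
    if *: "finite_measure P" "finite_measure N" "sets P = sets M" "sets N = sets M"
      "\<forall>A\<in>sets M. V A = measure P A - measure N A" "H \<in> sets M"
      "measure P (space M - H) = 0" "measure N H = 0"
      and **: "finite_measure P'" "finite_measure N'" "sets P' = sets M" "sets N' = sets M"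
      "\<forall>A\<in>sets M. V A = measure P' A - measure N' A" "H' \<in> sets M"
      "measure P' (space M - H') = 0" "measure N' H' = 0"
      and A: "A \<in> sets M" for P N P' N' :: "'a measure" and H H' A
  proof -
    interpret P: finite_measure P by fact
    interpret N: finite_measure N by fact
    interpret P': finite_measure P' by fact
    have AH: "A \<inter> H \<inter> H' \<in> sets M" "A \<inter> H - H' \<in> sets M" "A - H \<in> sets M" using A * ** by auto
    have sub: "A \<subseteq> space M" using A by (rule sets.sets_into_space)
    have "measure P (A - H) \<le> measure P (space M - H)"
      by (rule P.finite_measure_mono) (use sub * in auto)
    then have P0: "measure P (A - H) = 0" using *(7) measure_nonneg[of P "A - H"] by linarith
    have N0: "measure N B = 0" if "B \<subseteq> H" for B
    proof -
      have "measure N B \<le> measure N H"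
        by (rule N.finite_measure_mono[OF that]) (simp add: *(4,6))
      then show ?thesis using *(8) measure_nonneg[of N B] by linarith
    qed
    have "measure P' (A \<inter> H - H') \<le> measure P' (space M - H')"
      by (rule P'.finite_measure_mono) (use sub ** in auto)
    then have P'0: "measure P' (A \<inter> H - H') = 0"
      using **(7) measure_nonneg[of P' "A \<inter> H - H'"] by linarith
    have "measure P (A \<inter> H - H') = V (A \<inter> H - H')"
      using bspec[OF *(5) AH(2)] N0[of "A \<inter> H - H'"] by force
    also have "\<dots> \<le> 0" using bspec[OF **(5) AH(2)] P'0 by simp
    finally have P1: "measure P (A \<inter> H - H') = 0"
      using measure_nonneg[of P "A \<inter> H - H'"] by linarith
    have "measure P A = measure P ((A \<inter> H \<inter> H') \<union> ((A \<inter> H - H') \<union> (A - H)))"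
      by (rule arg_cong[where f = "measure P"]) auto
    also have "\<dots> = measure P (A \<inter> H \<inter> H') + (measure P (A \<inter> H - H') + measure P (A - H))"
    proof -
      have AP: "A \<inter> H \<inter> H' \<in> sets P" "A \<inter> H - H' \<in> sets P" "A - H \<in> sets P"
        using AH by (simp_all only: *(3))
      have "measure P ((A \<inter> H - H') \<union> (A - H)) = measure P (A \<inter> H - H') + measure P (A - H)"
        by (rule P.finite_measure_Union[OF AP(2,3)]) blast
      moreover have "measure P ((A \<inter> H \<inter> H') \<union> ((A \<inter> H - H') \<union> (A - H))) =
          measure P (A \<inter> H \<inter> H') + measure P ((A \<inter> H - H') \<union> (A - H))"
        by (rule P.finite_measure_Union[OF AP(1) sets.Un[OF AP(2,3)]]) blast
      ultimately show ?thesis by simp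
    qed
    also have "\<dots> = V (A \<inter> H \<inter> H')" using P0 P1 bspec[OF *(5) AH(1)] N0[of "A \<inter> H \<inter> H'"] by force
    finally show ?thesis .
  qed
  from assms obtain H H' where
    *: "finite_measure P" "finite_measure N" "sets P = sets M" "sets N = sets M"
      "\<forall>A\<in>sets M. V A = measure P A - measure N A" "H \<in> sets M"
      "measure P (space M - H) = 0" "measure N H = 0" and
    **: "finite_measure P'" "finite_measure N'" "sets P' = sets M" "sets N' = sets M"
      "\<forall>A\<in>sets M. V A = measure P' A - measure N' A" "H' \<in> sets M"
      "measure P' (space M - H') = 0" "measure N' H' = 0"
    unfolding is_jordan_decomposition_def by auto
  show ?thesis
  proof (rule measure_eqI)
    fix A assume "A \<in> sets P"
    then have A: "A \<in> sets M" using * by simp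
    have "measure P A = measure P' A"
      using key[OF * ** A] key[OF ** * A] by (simp add: Int_ac)
    then show "emeasure P A = emeasure P' A"
      using *(1) **(1) by (simp add: finite_measure.emeasure_eq_measure)
  qed (use * ** in simp)
qed

lemma jordan_eqI:
  assumes "is_jordan_decomposition M V P N"
  shows "jordan_pos M V = P" "jordan_neg M V = N"
proof -
  show "jordan_pos M V = P"
    unfolding jordan_pos_def using assms jordan_pos_unique by (blast intro: the_equality)
  show "jordan_neg M V = N"
    unfolding jordan_neg_def using assms jordan_pos_unique is_jordan_decomposition_uminus
    by (blast intro: the_equality)
qed

lemma is_jordan_decomposition_exists:
  assumes "finite_measure P0" "finite_measure N0" "sets P0 = sets M" "sets N0 = sets M"
    and V: "\<And>A. A \<in> sets M \<Longrightarrow> V A = measure P0 A - measure N0 A"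
  shows "is_jordan_decomposition M V (jordan_pos M V) (jordan_neg M V)"
proof -
  interpret P0: finite_measure P0 by fact
  interpret N0: finite_measure N0 by fact
  have spP: "space P0 = space M" and spN: "space N0 = space M"
    using assms by (auto dest: sets_eq_imp_space_eq)
  obtain H where H: "H \<in> sets P0"
      "\<And>X. X \<in> sets P0 \<Longrightarrow> X \<subseteq> H \<Longrightarrow> N0 X \<le> P0 X"
      "\<And>X. X \<in> sets P0 \<Longrightarrow> X \<inter> H = {} \<Longrightarrow> P0 X \<le> N0 X"
    using finite_unsigned_Hahn_decomposition[of P0 N0] assms by auto
  define f where "f = (\<lambda>Q R S. measure_of (space M) (sets M)
    (\<lambda>A. ennreal (measure (Q::'a measure) (A \<inter> S) - measure (R::'a measure) (A \<inter> S))))"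
  have part: "sets (f Q R S) = sets M \<and>
      (\<forall>A\<in>sets M. emeasure (f Q R S) A = ennreal (measure Q (A \<inter> S) - measure R (A \<inter> S)))"
    if Q: "finite_measure Q" "sets Q = sets M" and R: "finite_measure R" "sets R = sets M"
      and S: "S \<in> sets M" and le: "\<And>X. X \<in> sets M \<Longrightarrow> X \<subseteq> S \<Longrightarrow> measure R X \<le> measure Q X"
    for Q R S
  proof (intro conjI ballI)
    show "sets (f Q R S) = sets M" unfolding f_def by simp
    fix A assume A: "A \<in> sets M"
    show "emeasure (f Q R S) A = ennreal (measure Q (A \<inter> S) - measure R (A \<inter> S))"
    proof (rule emeasure_measure_of[where \<Omega> = "space M" and A = "sets M"])
      show "f Q R S = measure_of (space M) (sets M)
          (\<lambda>A. ennreal (measure Q (A \<inter> S) - measure R (A \<inter> S)))" by (simp add: f_def)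
      show "sets M \<subseteq> Pow (space M)" by (rule sets.space_closed)
      show "A \<in> sets (f Q R S)" using A by (simp add: f_def)
      show "positive (sets (f Q R S)) (\<lambda>A. ennreal (measure Q (A \<inter> S) - measure R (A \<inter> S)))"
        by (simp add: positive_def)
      show "countably_additive (sets (f Q R S))
          (\<lambda>A. ennreal (measure Q (A \<inter> S) - measure R (A \<inter> S)))"
      proof (rule countably_additiveI)
        fix B :: "nat \<Rightarrow> 'a set"
        assume B: "range B \<subseteq> sets (f Q R S)" "disjoint_family B"
        have BM: "B i \<in> sets M" for i using B(1) by (auto simp: f_def)
        have dis: "disjoint_family (\<lambda>i. B i \<inter> S)" using B(2) by (auto simp: disjoint_family_on_def)
        have "(\<lambda>i. measure Q (B i \<inter> S)) sums measure Q (\<Union>i. B i \<inter> S)"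
          by (rule finite_measure.finite_measure_UNION[OF Q(1)]) (use BM S Q dis in auto)
        moreover have "(\<lambda>i. measure R (B i \<inter> S)) sums measure R (\<Union>i. B i \<inter> S)"
          by (rule finite_measure.finite_measure_UNION[OF R(1)]) (use BM S R dis in auto)
        ultimately have "(\<lambda>i. measure Q (B i \<inter> S) - measure R (B i \<inter> S)) sums
            (measure Q (\<Union>i. B i \<inter> S) - measure R (\<Union>i. B i \<inter> S))"
          by (rule sums_diff)
        moreover have "0 \<le> measure Q (B i \<inter> S) - measure R (B i \<inter> S)" for i
          using le[of "B i \<inter> S"] BM[of i] S by auto
        ultimately have "(\<Sum>i. ennreal (measure Q (B i \<inter> S) - measure R (B i \<inter> S))) =
            ennreal (measure Q (\<Union>i. B i \<inter> S) - measure R (\<Union>i. B i \<inter> S))"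
          by (intro suminf_ennreal_eq)
        then show "(\<Sum>i. ennreal (measure Q (B i \<inter> S) - measure R (B i \<inter> S))) =
            ennreal (measure Q (\<Union> (range B) \<inter> S) - measure R (\<Union> (range B) \<inter> S))"
          by (simp only: Int_UN_distrib2[symmetric] UN_extend_simps)
      qed
    qed
  qed
  let ?H' = "space M - H"
  have HM: "H \<in> sets M" and H'M: "?H' \<in> sets M" using H(1) assms by auto
  have leP: "measure N0 X \<le> measure P0 X" if "X \<in> sets M" "X \<subseteq> H" for X
    using H(2)[of X] that assms
    by (simp add: P0.emeasure_eq_measure N0.emeasure_eq_measure)
  have leN: "measure P0 X \<le> measure N0 X" if "X \<in> sets M" "X \<subseteq> ?H'" for X
    using H(3)[of X] that assms
    by (force simp: P0.emeasure_eq_measure N0.emeasure_eq_measure)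
  define P N where "P = f P0 N0 H" and "N = f N0 P0 ?H'"
  have P: "sets P = sets M"
      "\<And>A. A \<in> sets M \<Longrightarrow> emeasure P A = ennreal (measure P0 (A \<inter> H) - measure N0 (A \<inter> H))"
    using part[of P0 N0 H] assms HM leP by (auto simp: P_def)
  have N: "sets N = sets M"
      "\<And>A. A \<in> sets M \<Longrightarrow> emeasure N A = ennreal (measure N0 (A \<inter> ?H') - measure P0 (A \<inter> ?H'))"
    using part[of N0 P0 ?H'] assms H'M leN by (auto simp: N_def)
  have mP: "measure P A = measure P0 (A \<inter> H) - measure N0 (A \<inter> H)" if "A \<in> sets M" for A
    using P(2)[OF that] leP[of "A \<inter> H"] that HM by (simp add: measure_def[of P])
  have mN: "measure N A = measure N0 (A \<inter> ?H') - measure P0 (A \<inter> ?H')" if "A \<in> sets M" for A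
    using N(2)[OF that] leN[of "A \<inter> ?H'"] sets.Int[OF that H'M] by (simp add: measure_def[of N])
  have "is_jordan_decomposition M V P N"
    unfolding is_jordan_decomposition_def
  proof (intro conjI ballI bexI[of _ H])
    show "finite_measure P" using P sets_eq_imp_space_eq[OF P(1)] by (intro finite_measureI) auto
    show "finite_measure N" using N sets_eq_imp_space_eq[OF N(1)] by (intro finite_measureI) auto
    fix A assume A: "A \<in> sets M"
    have eq: "A = (A \<inter> H) \<union> (A \<inter> ?H')" "A \<inter> H \<inter> (A \<inter> ?H') = {}"
      using sets.sets_into_space[OF A] by auto
    have "measure P0 A = measure P0 (A \<inter> H) + measure P0 (A \<inter> ?H')"
      using P0.finite_measure_Union[OF _ _ eq(2)] eq(1) A HM H'M assms by (metis sets.Int)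
    moreover have "measure N0 A = measure N0 (A \<inter> H) + measure N0 (A \<inter> ?H')"
      using N0.finite_measure_Union[OF _ _ eq(2)] eq(1) A HM H'M assms by (metis sets.Int)
    ultimately show "V A = measure P A - measure N A" using V[OF A] mP[OF A] mN[OF A] by simp
  next
    show "measure P (space M - H) = 0"
    proof -
      have e: "(space M - H) \<inter> H = {}" by auto
      show ?thesis using mP[OF H'M] unfolding e by simp
    qed
    show "measure N H = 0"
    proof -
      have e: "H \<inter> (space M - H) = {}" by auto
      show ?thesis using mN[OF HM] unfolding e by simp
    qed
  qed (use P N HM in auto)
  then show ?thesis by (simp add: jordan_eqI)
qed

end

theory Submission
  imports Defs "HOL-Combinatorics.Multiset_Permutations"
begin

text \<open>
  For a multiset \<open>n\<close> over \<open>I = {1..d}\<close> let \<open>U n\<close> be the convolution of the \<open>U r\<close> over \<open>r\<close> in \<open>n\<close>,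
  and let \<open>E\<close> be the expectation over \<open>n\<close> when the multiplicities are independent Poisson variables
  with means \<open>lam r\<close>. Then \<open>G = E (U n)\<close>, and multiplying by \<open>R j\<close> amounts to applying the
  difference operator \<open>D j f n = (\<Sum>r. p j r * (f (n + r) - f n))\<close> to \<open>f n = U n\<close>. The adjoint \<open>A j\<close>
  of \<open>D j\<close> under \<open>E\<close> gives \<open>(R 1 * \<dots> * R k) * G = E (h n * U n)\<close> with the multivariate Charlier
  polynomial \<open>h = A 1 (\<dots> (A k 1))\<close>, so the norm is at most \<open>E \<bar>h\<bar> \<le> sqrt (E h\<^sup>2)\<close>. The commutator of
  \<open>D i\<close> and \<open>A j\<close> is the scalar \<open>\<Sum>r. p i r * p j r / lam r\<close> and \<open>D i 1 = 0\<close>, so \<open>E h\<^sup>2\<close> is the permanent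
  of these scalars, which is the middle term of the claim. The second inequality is Cauchy-Schwarz
  over the permutations.
\<close>

section \<open>Signed mixtures of probability measures\<close>

lemma abs_summable_real: "(c :: 'j \<Rightarrow> real) summable_on J \<Longrightarrow> (\<lambda>j. \<bar>c j\<bar>) summable_on J"
  using summable_on_iff_abs_summable_on_real[of c J] by simp

lemma summable_on_diff_real:
  fixes f g :: "'j \<Rightarrow> real"
  shows "f summable_on J \<Longrightarrow> g summable_on J \<Longrightarrow> (\<lambda>j. f j - g j) summable_on J"
  using summable_on_add[of f J "\<lambda>j. - g j"] by (simp add: summable_on_uminus)

lemma infsum_diff_real:
  fixes f g :: "'j \<Rightarrow> real"
  shows "f summable_on J \<Longrightarrow> g summable_on J \<Longrightarrow> (\<Sum>\<^sub>\<infinity>j\<in>J. f j - g j) = infsum f J - infsum g J"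
  using infsum_add[of f J "\<lambda>j. - g j"] by (simp add: summable_on_uminus infsum_uminus)

lemma infsum_sum_real:
  fixes f :: "'k \<Rightarrow> 'j \<Rightarrow> real"
  assumes "finite S" "\<And>k. k \<in> S \<Longrightarrow> f k summable_on J"
  shows "(\<lambda>j. \<Sum>k\<in>S. f k j) summable_on J"
    and "(\<Sum>\<^sub>\<infinity>j\<in>J. \<Sum>k\<in>S. f k j) = (\<Sum>k\<in>S. infsum (f k) J)"
proof -
  have "(\<lambda>j. \<Sum>k\<in>S. f k j) summable_on J \<and> (\<Sum>\<^sub>\<infinity>j\<in>J. \<Sum>k\<in>S. f k j) = (\<Sum>k\<in>S. infsum (f k) J)"
    using assms by (induction S rule: finite_induct) (simp_all add: summable_on_add infsum_add)
  then show "(\<lambda>j. \<Sum>k\<in>S. f k j) summable_on J"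
    "(\<Sum>\<^sub>\<infinity>j\<in>J. \<Sum>k\<in>S. f k j) = (\<Sum>k\<in>S. infsum (f k) J)" by auto
qed

lemma summable_on_mult_bounded:
  fixes c h :: "'j \<Rightarrow> real"
  assumes "c summable_on J" "\<And>j. j \<in> J \<Longrightarrow> \<bar>h j\<bar> \<le> C"
  shows "(\<lambda>j. c j * h j) summable_on J"
proof -
  have "(\<lambda>j. norm (c j * C)) summable_on J"
    using abs_summable_real[OF summable_on_cmult_left[OF assms(1), of C]] by simp
  then have "(\<lambda>j. norm (c j * h j)) summable_on J"
  proof (rule Infinite_Sum.abs_summable_on_comparison_test)
    fix j assume "j \<in> J"
    then have "\<bar>h j\<bar> \<le> \<bar>C\<bar>" using assms(2)[of j] by linarith
    then show "norm (c j * h j) \<le> norm (c j * C)" by (simp add: abs_mult mult_left_mono)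
  qed
  then show ?thesis by (rule iffD2[OF summable_on_iff_abs_summable_on_real])
qed

lemma abs_infsum_mult_le:
  fixes c h :: "'j \<Rightarrow> real"
  assumes "c summable_on J" "\<And>j. j \<in> J \<Longrightarrow> \<bar>h j\<bar> \<le> C"
  shows "\<bar>\<Sum>\<^sub>\<infinity>j\<in>J. c j * h j\<bar> \<le> (\<Sum>\<^sub>\<infinity>j\<in>J. \<bar>c j\<bar>) * C"
proof -
  have s: "(\<lambda>j. c j * h j) summable_on J" by (rule summable_on_mult_bounded[OF assms])
  have "\<bar>\<Sum>\<^sub>\<infinity>j\<in>J. c j * h j\<bar> \<le> (\<Sum>\<^sub>\<infinity>j\<in>J. \<bar>c j * h j\<bar>)"
    using norm_infsum_bound[of "\<lambda>j. c j * h j" J] abs_summable_real[OF s] by simp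
  also have "\<dots> \<le> (\<Sum>\<^sub>\<infinity>j\<in>J. \<bar>c j\<bar> * C)"
    using assms by (intro infsum_mono abs_summable_real[OF s] summable_on_cmult_left abs_summable_real)
      (auto simp: abs_mult intro!: mult_left_mono)
  finally show ?thesis by (simp add: infsum_cmult_left')
qed

section \<open>Integration of bounded functions against a signed mixture\<close>

lemma abs_integral_le_bound:
  fixes f :: "'a \<Rightarrow> real"
  assumes "finite_measure Q" "\<And>x. x \<in> space Q \<Longrightarrow> \<bar>f x\<bar> \<le> C" "0 \<le> C"
  shows "\<bar>LINT x|Q. f x\<bar> \<le> C * measure Q (space Q)"
proof -
  interpret finite_measure Q by fact
  have "\<bar>LINT x|Q. f x\<bar> \<le> (LINT x|Q. C)"
  proof (cases "integrable Q f")
    case True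
    have "\<bar>LINT x|Q. f x\<bar> \<le> (LINT x|Q. \<bar>f x\<bar>)" by simp
    also have "\<dots> \<le> (LINT x|Q. C)"
      using True assms(2) by (intro integral_mono) auto
    finally show ?thesis .
  next
    case False
    then show ?thesis using assms(3) by (simp add: not_integrable_integral_eq)
  qed
  then show ?thesis by (simp add: mult.commute)
qed

lemma integrable_bounded:
  fixes f :: "'a \<Rightarrow> real"
  assumes "finite_measure Q" "sets Q = sets M" "f \<in> borel_measurable M" "\<And>x. \<bar>f x\<bar> \<le> C"
  shows "integrable Q f"
proof -
  have "f \<in> borel_measurable Q" using assms(2,3) by (simp cong: measurable_cong_sets)
  then show ?thesis using assms by (intro finite_measure.integrable_const_bound[where B = C]) auto
qed

text \<open>The hypothesis \<open>eq\<close> is the case of indicator functions. A bounded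
  measurable \<open>f\<close> is a uniform limit of step functions, and the defect \<open>D\<close>
  is continuous under uniform convergence because the total mass \<open>K\<close> of all measures
  involved is finite.\<close>

lemma integral_diff_eq_infsum:
  fixes c :: "'j \<Rightarrow> real" and f :: "'a \<Rightarrow> real"
  assumes P: "finite_measure P" "sets P = sets M" and N: "finite_measure N" "sets N = sets M"
    and c: "c summable_on J"
    and \<kappa>: "\<And>j. j \<in> J \<Longrightarrow> prob_space (\<kappa> j)" "\<And>j. j \<in> J \<Longrightarrow> sets (\<kappa> j) = sets M"
    and eq: "\<And>A. A \<in> sets M \<Longrightarrow> measure P A - measure N A = (\<Sum>\<^sub>\<infinity>j\<in>J. c j * measure (\<kappa> j) A)"
    and f: "f \<in> borel_measurable M" "\<And>x. \<bar>f x\<bar> \<le> C"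
  shows "(LINT x|P. f x) - (LINT x|N. f x) = (\<Sum>\<^sub>\<infinity>j\<in>J. c j * (LINT x|\<kappa> j. f x))"
proof -
  have f\<kappa>: "finite_measure (\<kappa> j)" if "j \<in> J" for j
    using \<kappa>(1)[OF that] by (rule prob_space.finite_measure)
  define D where "D g = (LINT x|P. g x) - (LINT x|N. g x) - (\<Sum>\<^sub>\<infinity>j\<in>J. c j * (LINT x|\<kappa> j. g x))"
    for g :: "'a \<Rightarrow> real"
  define K where "K = measure P (space P) + measure N (space N) + (\<Sum>\<^sub>\<infinity>j\<in>J. \<bar>c j\<bar>)"
  have bound: "\<bar>D f\<bar> \<le> K / Suc n" for n
  proof -
    \<comment> \<open>Rounding \<open>f\<close> down to a multiple of \<open>1 / Suc n\<close> gives
      the step function \<open>g\<close>. Since \<open>f\<close> is bounded by \<open>C\<close>,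
      only levels \<open>k\<close> in the finite set \<open>S\<close> occur.\<close>
    define A where "A k = {x \<in> space M. \<lfloor>Suc n * f x\<rfloor> = k}" for k
    define S where "S = {\<lfloor>- (Suc n * C)\<rfloor>..\<lfloor>Suc n * C\<rfloor>}"
    define g where "g x = (\<Sum>k\<in>S. of_int k / Suc n * indicator (A k) x)" for x
    have A: "A k \<in> sets M" for k
    proof -
      have "(\<lambda>x. \<lfloor>Suc n * f x\<rfloor>) \<in> measurable M (count_space UNIV)" using f(1) by measurable
      then show ?thesis unfolding A_def by measurable
    qed
    have g_eq: "g x = of_int \<lfloor>Suc n * f x\<rfloor> / Suc n" if x: "x \<in> space M" for x
    proof -
      have fx: "- C \<le> f x" "f x \<le> C" using f(2)[of x] by linarith+
      have "Suc n * - C \<le> Suc n * f x" "Suc n * f x \<le> Suc n * C"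
        by (rule mult_left_mono[OF fx(1)], simp) (rule mult_left_mono[OF fx(2)], simp)
      then have "\<lfloor>Suc n * f x\<rfloor> \<in> S" unfolding S_def by (auto intro!: floor_mono)
      moreover have "g x = (\<Sum>k\<in>S. if k = \<lfloor>Suc n * f x\<rfloor> then of_int k / Suc n else 0)"
        unfolding g_def using x by (intro sum.cong) (auto simp: A_def indicator_def)
      ultimately show ?thesis by (simp add: S_def)
    qed
    have fg: "\<bar>f x - g x\<bar> \<le> 1 / Suc n" if x: "x \<in> space M" for x
    proof -
      have "\<bar>Suc n * f x - of_int \<lfloor>Suc n * f x\<rfloor>\<bar> \<le> 1"
        using of_int_floor_le[of "Suc n * f x"] real_of_int_floor_add_one_ge[of "Suc n * f x"]
        by linarith
      then have "\<bar>Suc n * f x - of_int \<lfloor>Suc n * f x\<rfloor>\<bar> / Suc n \<le> 1 / Suc n"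
        by (rule divide_right_mono) simp
      moreover have "f x - g x = (Suc n * f x - of_int \<lfloor>Suc n * f x\<rfloor>) / Suc n"
        by (simp add: g_eq[OF x] diff_divide_distrib del: of_nat_Suc)
      ultimately show ?thesis by (simp add: abs_divide del: of_nat_Suc)
    qed
    have Qg: "(LINT x|Q. g x) = (\<Sum>k\<in>S. of_int k / Suc n * measure Q (A k))"
      and Qfg: "\<bar>(LINT x|Q. f x) - (LINT x|Q. g x)\<bar> \<le> 1 / Suc n * measure Q (space Q)"
      if Q: "finite_measure Q" "sets Q = sets M" for Q
    proof -
      interpret finite_measure Q by fact
      have AQ: "A k \<in> sets Q" for k using A Q by simp
      have sp: "space Q = space M" using Q(2) by (rule sets_eq_imp_space_eq)
      have int: "integrable Q (\<lambda>x. of_int k / Suc n * indicator (A k) x :: real)" for k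
        using AQ[of k] by (intro integrable_mult_right integrable_real_indicator) (auto simp: emeasure_eq_measure)
      then have ig: "integrable Q g" unfolding g_def by (intro Bochner_Integration.integrable_sum)
      show "(LINT x|Q. g x) = (\<Sum>k\<in>S. of_int k / Suc n * measure Q (A k))"
        unfolding g_def using int AQ sets.sets_into_space[OF AQ] by (subst Bochner_Integration.integral_sum) (auto simp: Int_absorb2)
      have "(LINT x|Q. f x) - (LINT x|Q. g x) = (LINT x|Q. f x - g x)"
        using ig integrable_bounded[OF Q f] by simp
      also have "\<bar>\<dots>\<bar> \<le> 1 / Suc n * measure Q (space Q)"
        using fg Q(1) unfolding sp[symmetric] by (intro abs_integral_le_bound) auto
      finally show "\<bar>(LINT x|Q. f x) - (LINT x|Q. g x)\<bar> \<le> 1 / Suc n * measure Q (space Q)" .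
    qed
    have s: "(\<lambda>j. c j * measure (\<kappa> j) (A k)) summable_on J" for k
      using \<kappa>(1) by (intro summable_on_mult_bounded[OF c, of _ 1]) (auto simp: prob_space.prob_le_1)
    \<comment> \<open>Finiteness of \<open>S\<close> allows the exchange with the sum over
      \<open>J\<close>, and \<open>eq\<close> applies to each level set.\<close>
    have "D g = 0"
    proof -
      have "(\<Sum>\<^sub>\<infinity>j\<in>J. c j * (LINT x|\<kappa> j. g x))
          = (\<Sum>\<^sub>\<infinity>j\<in>J. \<Sum>k\<in>S. of_int k / Suc n * (c j * measure (\<kappa> j) (A k)))"
        using f\<kappa> \<kappa>(2) by (intro infsum_cong) (simp add: Qg sum_distrib_left mult_ac)
      also have "\<dots> = (\<Sum>k\<in>S. of_int k / Suc n * (\<Sum>\<^sub>\<infinity>j\<in>J. c j * measure (\<kappa> j) (A k)))"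
        by (subst infsum_sum_real(2)[OF _ summable_on_cmult_right[OF s]])
          (simp_all add: infsum_cmult_right' S_def del: times_divide_eq_left)
      also have "\<dots> = (\<Sum>k\<in>S. of_int k / Suc n * (measure P (A k) - measure N (A k)))"
        by (simp add: eq A)
      finally show ?thesis
        by (simp add: D_def Qg P N sum_subtractf algebra_simps diff_divide_distrib)
    qed
    moreover have "\<bar>D f - D g\<bar> \<le> K / Suc n"
    proof -
      have b: "\<bar>LINT x|\<kappa> j. h x\<bar> \<le> C'" if "j \<in> J" "\<And>x. x \<in> space M \<Longrightarrow> \<bar>h x\<bar> \<le> C'" "0 \<le> C'"
        for j C' and h :: "'a \<Rightarrow> real"
        using abs_integral_le_bound[OF f\<kappa>[OF that(1)], of h C'] that
          sets_eq_imp_space_eq[OF \<kappa>(2)[OF that(1)]] prob_space.prob_space[OF \<kappa>(1)[OF that(1)]] by simp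
      have gC: "\<bar>g x\<bar> \<le> C + 1" if "x \<in> space M" for x
      proof -
        have "1 / Suc n \<le> (1::real)" by simp
        then show ?thesis using fg[OF that] f(2)[of x] by linarith
      qed
      \<comment> \<open>Any point of the type serves here, since \<open>C\<close> dominates an
        absolute value at it.\<close>
      have C: "0 \<le> C" using f(2)[of undefined] by linarith
      have s1: "(\<lambda>j. c j * (LINT x|\<kappa> j. f x)) summable_on J"
        using f C by (intro summable_on_mult_bounded[OF c, of _ C] b) auto
      have s2: "(\<lambda>j. c j * (LINT x|\<kappa> j. g x)) summable_on J"
        using gC C by (intro summable_on_mult_bounded[OF c, of _ "C + 1"] b) auto
      have "(\<Sum>\<^sub>\<infinity>j\<in>J. c j * (LINT x|\<kappa> j. f x)) - (\<Sum>\<^sub>\<infinity>j\<in>J. c j * (LINT x|\<kappa> j. g x))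
          = (\<Sum>\<^sub>\<infinity>j\<in>J. c j * ((LINT x|\<kappa> j. f x) - (LINT x|\<kappa> j. g x)))"
        by (simp add: right_diff_distrib infsum_diff_real s1 s2)
      also have "\<bar>\<dots>\<bar> \<le> (\<Sum>\<^sub>\<infinity>j\<in>J. \<bar>c j\<bar>) * (1 / Suc n)"
      proof (rule abs_infsum_mult_le[OF c])
        fix j assume j: "j \<in> J"
        show "\<bar>(LINT x|\<kappa> j. f x) - (LINT x|\<kappa> j. g x)\<bar> \<le> 1 / Suc n"
          using Qfg[OF f\<kappa>[OF j] \<kappa>(2)[OF j]] prob_space.prob_space[OF \<kappa>(1)[OF j]] by simp
      qed
      finally have "\<bar>(\<Sum>\<^sub>\<infinity>j\<in>J. c j * (LINT x|\<kappa> j. f x)) - (\<Sum>\<^sub>\<infinity>j\<in>J. c j * (LINT x|\<kappa> j. g x))\<bar>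
          \<le> (\<Sum>\<^sub>\<infinity>j\<in>J. \<bar>c j\<bar>) * (1 / Suc n)" .
      moreover have "K / Suc n = 1 / Suc n * measure P (space P) + 1 / Suc n * measure N (space N)
          + (\<Sum>\<^sub>\<infinity>j\<in>J. \<bar>c j\<bar>) * (1 / Suc n)"
        by (simp add: K_def add_divide_distrib)
      ultimately show ?thesis using Qfg[OF P] Qfg[OF N] unfolding D_def by linarith
    qed
    ultimately show ?thesis by simp
  qed
  have "(\<lambda>n. K / Suc n) \<longlonglongrightarrow> 0"
    using tendsto_mult_left[OF LIMSEQ_inverse_real_of_nat, of K] by (simp add: divide_inverse)
  then have "\<bar>D f\<bar> \<le> 0" using bound by (intro LIMSEQ_le_const) auto
  then show ?thesis by (simp add: D_def)
qed

section \<open>Jordan decomposition, integral and norm of a signed mixture\<close>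

lemma mixture_exists:
  fixes c :: "'j \<Rightarrow> real"
  assumes "c summable_on J" "\<And>j. j \<in> J \<Longrightarrow> 0 \<le> c j" "J \<noteq> {}"
    and \<kappa>: "\<And>j. j \<in> J \<Longrightarrow> prob_space (\<kappa> j)" "\<And>j. j \<in> J \<Longrightarrow> sets (\<kappa> j) = sets M"
  obtains Q where "finite_measure Q" "sets Q = sets M"
    "\<And>A. A \<in> sets M \<Longrightarrow> measure Q A = (\<Sum>\<^sub>\<infinity>j\<in>J. c j * measure (\<kappa> j) A)"
proof
  \<comment> \<open>The mixture is the monadic bind of the kernel \<open>\<kappa>\<close> with the
    counting measure on \<open>J\<close> weighted by \<open>c\<close>. As \<open>J\<close> is
    nonempty, the bind inherits the sigma-algebra of \<open>M\<close>.\<close>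
  define Q where "Q = density (count_space J) (\<lambda>j. ennreal (c j)) \<bind> \<kappa>"
  have meas: "\<kappa> \<in> measurable (density (count_space J) (\<lambda>j. ennreal (c j))) (subprob_algebra M)"
    using \<kappa> by (auto simp: space_subprob_algebra intro: prob_space_imp_subprob_space)
  show sQ: "sets Q = sets M"
    unfolding Q_def using assms(3) \<kappa>(2) by (intro sets_bind) auto
  have em: "emeasure Q A = ennreal (\<Sum>\<^sub>\<infinity>j\<in>J. c j * measure (\<kappa> j) A)" if A: "A \<in> sets M" for A
  proof -
    have s: "(\<lambda>j. c j * measure (\<kappa> j) A) summable_on J"
      using \<kappa>(1) by (intro summable_on_mult_bounded[OF assms(1), of _ 1]) (auto simp: prob_space.prob_le_1)
    then have as: "Infinite_Set_Sum.abs_summable_on (\<lambda>j. c j * measure (\<kappa> j) A) J"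
      by (intro abs_summable_equivalent[THEN iffD1] iffD1[OF summable_on_iff_abs_summable_on_real])
    have "emeasure Q A = (\<integral>\<^sup>+j. emeasure (\<kappa> j) A \<partial>density (count_space J) (\<lambda>j. ennreal (c j)))"
      unfolding Q_def using assms(3) meas A by (intro emeasure_bind) auto
    also have "\<dots> = (\<integral>\<^sup>+j. ennreal (c j) * emeasure (\<kappa> j) A \<partial>count_space J)"
      by (subst nn_integral_density) auto
    also have "\<dots> = (\<integral>\<^sup>+j. ennreal (c j * measure (\<kappa> j) A) \<partial>count_space J)"
      using \<kappa>(1) assms(2) by (intro nn_integral_cong)
        (simp add: ennreal_mult finite_measure.emeasure_eq_measure prob_space.finite_measure)
    also have "\<dots> = ennreal (infsetsum (\<lambda>j. c j * measure (\<kappa> j) A) J)"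
      using assms(2) by (intro nn_integral_conv_infsetsum as) auto
    finally show ?thesis by (simp add: infsetsum_infsum[OF as])
  qed
  show "finite_measure Q"
    using em[of "space M"] sets_eq_imp_space_eq[OF sQ] by (intro finite_measureI) simp
  show "measure Q A = (\<Sum>\<^sub>\<infinity>j\<in>J. c j * measure (\<kappa> j) A)" if "A \<in> sets M" for A
    using em[OF that] assms(2) by (simp add: measure_def infsum_nonneg)
qed

text \<open>Splitting the coefficients by sign writes \<open>V\<close> as a difference of two finite
  mixtures. These may overlap, but \<open>is_jordan_decomposition_exists\<close> only asks for some
  difference of finite measures.\<close>

lemma is_jordan_decomposition_mixture:
  fixes c :: "'j \<Rightarrow> real"
  assumes c: "c summable_on J"
    and \<kappa>: "\<And>j. j \<in> J \<Longrightarrow> prob_space (\<kappa> j)" "\<And>j. j \<in> J \<Longrightarrow> sets (\<kappa> j) = sets M"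
    and V: "\<And>A. A \<in> sets M \<Longrightarrow> V A = (\<Sum>\<^sub>\<infinity>j\<in>J. c j * measure (\<kappa> j) A)"
  shows "is_jordan_decomposition M V (jordan_pos M V) (jordan_neg M V)"
proof (cases "J = {}")
  case True
  \<comment> \<open>For empty \<open>J\<close> the set function vanishes on measurable sets;
    \<open>mixture_exists\<close> covers nonempty index sets only.\<close>
  show ?thesis
    by (rule is_jordan_decomposition_exists[of "null_measure M" "null_measure M"])
      (auto simp: V True intro!: finite_measureI)
next
  case False
  have s: "(\<lambda>j. max 0 (c j)) summable_on J" "(\<lambda>j. max 0 (- c j)) summable_on J"
  proof -
    have "(\<lambda>j. (\<bar>c j\<bar> + c j) * (1 / 2)) summable_on J" "(\<lambda>j. (\<bar>c j\<bar> - c j) * (1 / 2)) summable_on J"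
      by (intro summable_on_cmult_left summable_on_add summable_on_diff_real abs_summable_real c)+
    moreover have "(\<lambda>j. (\<bar>c j\<bar> + c j) * (1 / 2)) = (\<lambda>j. max 0 (c j))"
      "(\<lambda>j. (\<bar>c j\<bar> - c j) * (1 / 2)) = (\<lambda>j. max 0 (- c j))" by (auto simp: max_def)
    ultimately show "(\<lambda>j. max 0 (c j)) summable_on J" "(\<lambda>j. max 0 (- c j)) summable_on J"
      by simp_all
  qed
  obtain P where P: "finite_measure P" "sets P = sets M"
    "\<And>A. A \<in> sets M \<Longrightarrow> measure P A = (\<Sum>\<^sub>\<infinity>j\<in>J. max 0 (c j) * measure (\<kappa> j) A)"
    by (rule mixture_exists[OF s(1) _ False \<kappa>]) auto
  obtain N where N: "finite_measure N" "sets N = sets M"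
    "\<And>A. A \<in> sets M \<Longrightarrow> measure N A = (\<Sum>\<^sub>\<infinity>j\<in>J. max 0 (- c j) * measure (\<kappa> j) A)"
    by (rule mixture_exists[OF s(2) _ False \<kappa>]) auto
  show ?thesis
  proof (rule is_jordan_decomposition_exists[OF P(1) N(1) P(2) N(2)])
    fix A assume A: "A \<in> sets M"
    have "(\<lambda>j. c' j * measure (\<kappa> j) A) summable_on J" if "c' summable_on J" for c' :: "'j \<Rightarrow> real"
      using \<kappa>(1) by (intro summable_on_mult_bounded[OF that, of _ 1]) (auto simp: prob_space.prob_le_1)
    then have "measure P A - measure N A
        = (\<Sum>\<^sub>\<infinity>j\<in>J. max 0 (c j) * measure (\<kappa> j) A - max 0 (- c j) * measure (\<kappa> j) A)"
      using s by (simp add: P(3) N(3) A infsum_diff_real)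
    also have "\<dots> = V A"
      unfolding V[OF A] by (intro infsum_cong) (auto simp: max_def)
    finally show "V A = measure P A - measure N A" ..
  qed
qed

text \<open>The Jordan parts of \<open>V\<close> are known only through their difference on sets,
  which is exactly the information that \<open>integral_diff_eq_infsum\<close> takes.\<close>

lemma signed_integral_mixture:
  fixes c :: "'j \<Rightarrow> real"
  assumes c: "c summable_on J"
    and \<kappa>: "\<And>j. j \<in> J \<Longrightarrow> prob_space (\<kappa> j)" "\<And>j. j \<in> J \<Longrightarrow> sets (\<kappa> j) = sets M"
    and V: "\<And>A. A \<in> sets M \<Longrightarrow> V A = (\<Sum>\<^sub>\<infinity>j\<in>J. c j * measure (\<kappa> j) A)"
    and f: "f \<in> borel_measurable M" "\<And>x. \<bar>f x\<bar> \<le> C"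
  shows "signed_integral M V f = (\<Sum>\<^sub>\<infinity>j\<in>J. c j * (LINT x|\<kappa> j. f x))"
proof -
  have "is_jordan_decomposition M V (jordan_pos M V) (jordan_neg M V)"
    by (rule is_jordan_decomposition_mixture[OF c \<kappa> V])
  then show ?thesis
    unfolding is_jordan_decomposition_def signed_integral_def
    using V by (intro integral_diff_eq_infsum[OF _ _ _ _ c \<kappa> _ f]) auto
qed

text \<open>With a Hahn set \<open>H\<close> the norm is \<open>V H - V (space M - H)\<close>, and a
  probability measure contributes at most 1 in absolute value to this difference.\<close>

lemma tv_norm_mixture_le:
  fixes c :: "'j \<Rightarrow> real"
  assumes c: "c summable_on J"
    and \<kappa>: "\<And>j. j \<in> J \<Longrightarrow> prob_space (\<kappa> j)" "\<And>j. j \<in> J \<Longrightarrow> sets (\<kappa> j) = sets M"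
    and V: "\<And>A. A \<in> sets M \<Longrightarrow> V A = (\<Sum>\<^sub>\<infinity>j\<in>J. c j * measure (\<kappa> j) A)"
  shows "tv_norm M V \<le> (\<Sum>\<^sub>\<infinity>j\<in>J. \<bar>c j\<bar>)"
proof -
  define P N where "P = jordan_pos M V" and "N = jordan_neg M V"
  have "is_jordan_decomposition M V P N"
    unfolding P_def N_def by (rule is_jordan_decomposition_mixture[OF c \<kappa> V])
  then obtain H where J: "finite_measure P" "finite_measure N" "sets P = sets M" "sets N = sets M"
    "\<And>A. A \<in> sets M \<Longrightarrow> V A = measure P A - measure N A"
    "H \<in> sets M" "measure P (space M - H) = 0" "measure N H = 0"
    unfolding is_jordan_decomposition_def by blast
  have split: "measure Q (space M) = measure Q H + measure Q (space M - H)"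
    if "finite_measure Q" "sets Q = sets M" for Q
    using finite_measure.finite_measure_compl[OF that(1), of H] J(6) that
      sets_eq_imp_space_eq[OF that(2)] by simp
  have H': "space M - H \<in> sets M" using J(6) by auto
  have s: "(\<lambda>j. c j * measure (\<kappa> j) A) summable_on J" for A
    using \<kappa>(1) by (intro summable_on_mult_bounded[OF c, of _ 1]) (auto simp: prob_space.prob_le_1)
  \<comment> \<open>\<open>P\<close> is carried by \<open>H\<close> and \<open>N\<close> by its
    complement, so their total masses are \<open>V H\<close> and
    \<open>- V (space M - H)\<close>.\<close>
  have "tv_norm M V = V H - V (space M - H)"
    using split[OF J(1,3)] split[OF J(2,4)] J(5)[OF J(6)] J(5)[OF H'] J(7,8)
    by (simp add: tv_norm_def P_def[symmetric] N_def[symmetric])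
  also have "\<dots> = (\<Sum>\<^sub>\<infinity>j\<in>J. c j * (measure (\<kappa> j) H - measure (\<kappa> j) (space M - H)))"
    by (simp add: V J(6) H' right_diff_distrib infsum_diff_real s)
  also have "\<dots> \<le> (\<Sum>\<^sub>\<infinity>j\<in>J. \<bar>c j\<bar>) * 1"
  proof (rule order_trans[OF abs_ge_self abs_infsum_mult_le[OF c]])
    fix j assume "j \<in> J"
    then show "\<bar>measure (\<kappa> j) H - measure (\<kappa> j) (space M - H)\<bar> \<le> 1"
      using prob_space.prob_le_1[OF \<kappa>(1), of j] measure_nonneg[of "\<kappa> j"]
      by (smt (verit))
  qed
  finally show ?thesis by simp
qed

section \<open>Independent Poisson multiplicities and Charlier polynomials\<close>

text \<open>Exponent 0 would give 2 \<le> 1; this is why the bound in \<open>exp_growth\<close> has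
  exponent \<open>Suc (size n)\<close>.\<close>

lemma power_add_le_add_power:
  fixes a b :: real
  assumes "0 \<le> a" "0 \<le> b"
  shows "a ^ Suc m + b ^ Suc m \<le> (a + b) ^ Suc m"
proof (induction m)
  case (Suc m)
  have "a ^ Suc (Suc m) + b ^ Suc (Suc m) \<le> (a + b) * (a ^ Suc m + b ^ Suc m)"
    using assms by (simp add: algebra_simps)
  also have "\<dots> \<le> (a + b) * (a + b) ^ Suc m"
    using Suc assms by (intro mult_left_mono) auto
  finally show ?case by simp
qed simp

lemma count_le_two_power_size: "real (count n r) \<le> 2 ^ size n"
proof -
  have "count n r \<le> size n" by (rule count_le_size)
  also have "\<dots> \<le> 2 ^ size n" by (rule less_imp_le[OF less_exp])
  finally show ?thesis by (metis of_nat_le_iff of_nat_numeral of_nat_power)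
qed

locale multi_poisson =
  fixes I :: "'i set" and lam :: "'i \<Rightarrow> real"
  assumes finite_I: "finite I" and lam_pos: "r \<in> I \<Longrightarrow> lam r > 0"
begin

definition msets :: "'i multiset set" where
  "msets = {n. set_mset n \<subseteq> I}"

text \<open>The joint Poisson point probability without its factor \<open>exp (- sum lam I)\<close>,
  which \<open>expct\<close> supplies.\<close>

definition weight :: "'i multiset \<Rightarrow> real" where
  "weight n = (\<Prod>r\<in>I. lam r ^ count n r / fact (count n r))"

definition expct :: "('i multiset \<Rightarrow> real) \<Rightarrow> real" where
  "expct g = exp (- sum lam I) * (\<Sum>\<^sub>\<infinity>n\<in>msets. weight n * g n)"

text \<open>One constant \<open>K\<close> plays both prefactor and rate. The class is closed under
  sums, products and shifts, contains the multiplicities, and is summable against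
  \<open>weight\<close>.\<close>

definition exp_growth :: "('i multiset \<Rightarrow> real) \<Rightarrow> bool" where
  "exp_growth g \<longleftrightarrow> (\<exists>K\<ge>1. \<forall>n\<in>msets. \<bar>g n\<bar> \<le> K ^ Suc (size n))"

text \<open>On functions of multisets this represents convolution with the sum of \<open>p r\<close>
  times \<open>U r\<close>, just as \<open>diff_op\<close> represents convolution with the sum of
  \<open>p r\<close> times \<open>U r - dirac M 0\<close>.\<close>

definition shift_sum :: "('i \<Rightarrow> real) \<Rightarrow> ('i multiset \<Rightarrow> real) \<Rightarrow> 'i multiset \<Rightarrow> real" where
  "shift_sum p g n = (\<Sum>r\<in>I. p r * g (add_mset r n))"

definition diff_op :: "('i \<Rightarrow> real) \<Rightarrow> ('i multiset \<Rightarrow> real) \<Rightarrow> 'i multiset \<Rightarrow> real" where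
  "diff_op p g n = (\<Sum>r\<in>I. p r * (g (add_mset r n) - g n))"

text \<open>The adjoint of \<open>diff_op p\<close> under \<open>expct\<close>. Where
  \<open>r\<close> is absent from \<open>n\<close>, the truncated \<open>n - {#r#}\<close> is
  multiplied by the zero count.\<close>

definition creation_op :: "('i \<Rightarrow> real) \<Rightarrow> ('i multiset \<Rightarrow> real) \<Rightarrow> 'i multiset \<Rightarrow> real" where
  "creation_op p g n = (\<Sum>r\<in>I. p r * (count n r / lam r * g (n - {#r#}) - g n))"

definition inner_lam :: "('i \<Rightarrow> real) \<Rightarrow> ('i \<Rightarrow> real) \<Rightarrow> real" where
  "inner_lam p q = (\<Sum>r\<in>I. p r * q r / lam r)"

lemma add_mset_in_msets: "add_mset r n \<in> msets \<longleftrightarrow> r \<in> I \<and> n \<in> msets"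
  by (auto simp: msets_def)

lemma empty_in_msets [simp]: "{#} \<in> msets"
  by (simp add: msets_def)

lemma minus_in_msets: "n \<in> msets \<Longrightarrow> n - m \<in> msets"
  by (auto simp: msets_def dest: in_diffD)

lemma finite_msets_of_size: "finite {n \<in> msets. size n = m}"
  using finite_multisets_of_size[OF finite_I, of m]
  by (simp add: msets_def multisets_of_size_def)

lemma weight_nonneg: "weight n \<ge> 0"
  unfolding weight_def by (intro prod_nonneg) (auto dest: lam_pos intro: less_imp_le)

lemma weight_empty [simp]: "weight {#} = 1"
  by (simp add: weight_def)

lemma weight_add_mset:
  assumes "r \<in> I"
  shows "weight (add_mset r n) * (count n r + 1) = lam r * weight n"
proof -
  have *: "weight m = lam r ^ count m r / fact (count m r)
      * (\<Prod>s\<in>I - {r}. lam s ^ count m s / fact (count m s))" for m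
    unfolding weight_def using finite_I assms by (rule prod.remove)
  have "(\<Prod>s\<in>I - {r}. lam s ^ count (add_mset r n) s / fact (count (add_mset r n) s))
      = (\<Prod>s\<in>I - {r}. lam s ^ count n s / fact (count n s))"
    by (intro prod.cong) auto
  moreover have "lam r ^ Suc m / fact (Suc m) * (real m + 1) = lam r * (lam r ^ m / fact m)" for m
    by (simp add: divide_simps add_ac)
  ultimately show ?thesis
    unfolding *[of n] *[of "add_mset r n"] by (simp add: mult_ac)
qed

text \<open>Mecke's formula. Both sides are reindexings of each other, so no summability is needed.\<close>

lemma infsum_weight_count:
  fixes g :: "'i multiset \<Rightarrow> real"
  assumes "r \<in> I"
  shows "(\<Sum>\<^sub>\<infinity>n\<in>msets. weight n * (count n r * g (n - {#r#})))
    = lam r * (\<Sum>\<^sub>\<infinity>n\<in>msets. weight n * g n)"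
proof -
  \<comment> \<open>Only multisets containing \<open>r\<close> contribute, and these are the image
    of \<open>add_mset r\<close>.\<close>
  have "(\<Sum>\<^sub>\<infinity>n\<in>msets. weight n * (count n r * g (n - {#r#})))
      = (\<Sum>\<^sub>\<infinity>n\<in>add_mset r ` msets. weight n * (count n r * g (n - {#r#})))"
  proof (rule infsum_cong_neutral)
    fix n assume n: "n \<in> msets - add_mset r ` msets"
    have "count n r = 0"
    proof (rule ccontr)
      assume "count n r \<noteq> 0"
      then have "n = add_mset r (n - {#r#})" by (simp add: count_eq_zero_iff)
      then show False using n minus_in_msets by blast
    qed
    then show "weight n * (count n r * g (n - {#r#})) = 0" by simp
  qed (auto simp: add_mset_in_msets assms)
  also have "\<dots> = (\<Sum>\<^sub>\<infinity>n\<in>msets. lam r * (weight n * g n))"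
    by (subst infsum_reindex)
      (auto simp: inj_on_def o_def weight_add_mset[OF assms, symmetric] mult_ac intro!: infsum_cong)
  finally show ?thesis by (simp add: infsum_cmult_right')
qed

lemma expct_count:
  fixes g :: "'i multiset \<Rightarrow> real"
  shows "r \<in> I \<Longrightarrow> expct (\<lambda>n. count n r * g (n - {#r#})) = lam r * expct g"
  unfolding expct_def by (simp add: infsum_weight_count)

section \<open>Functions of exponential growth in the size of the multiset\<close>

lemma exp_growthI:
  "K \<ge> 1 \<Longrightarrow> (\<And>n. n \<in> msets \<Longrightarrow> \<bar>g n\<bar> \<le> K ^ Suc (size n)) \<Longrightarrow> exp_growth g"
  unfolding exp_growth_def by blast

lemma exp_growth_bounded:
  assumes "\<And>n. n \<in> msets \<Longrightarrow> \<bar>g n\<bar> \<le> C"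
  shows "exp_growth g"
proof (rule exp_growthI[of "max 1 C"])
  fix n assume "n \<in> msets"
  then have "\<bar>g n\<bar> \<le> max 1 C" using assms[of n] by simp
  also have "\<dots> \<le> max 1 C ^ Suc (size n)" using power_increasing[of 1 "Suc (size n)" "max 1 C"] by simp
  finally show "\<bar>g n\<bar> \<le> max 1 C ^ Suc (size n)" .
qed simp

lemma exp_growth_const: "exp_growth (\<lambda>_. c)"
  by (rule exp_growth_bounded[of _ "\<bar>c\<bar>"]) simp

lemma exp_growth_count: "exp_growth (\<lambda>n. real (count n r))"
proof (rule exp_growthI[of 2])
  fix n :: "'i multiset"
  show "\<bar>real (count n r)\<bar> \<le> 2 ^ Suc (size n)"
    using count_le_two_power_size[of n r] zero_le_power[of "2::real" "size n"]
    unfolding abs_of_nat power_Suc by linarith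
qed simp

lemma exp_growth_mult:
  assumes "exp_growth f" "exp_growth g"
  shows "exp_growth (\<lambda>n. f n * g n)"
proof -
  obtain K L where "K \<ge> 1" "\<And>n. n \<in> msets \<Longrightarrow> \<bar>f n\<bar> \<le> K ^ Suc (size n)"
    "L \<ge> 1" "\<And>n. n \<in> msets \<Longrightarrow> \<bar>g n\<bar> \<le> L ^ Suc (size n)"
    using assms unfolding exp_growth_def by blast
  then show ?thesis
    using mult_mono[of 1 K 1 L]
    by (intro exp_growthI[of "K * L"]) (auto simp: abs_mult power_mult_distrib simp del: power_Suc intro!: mult_mono)
qed

lemma exp_growth_add:
  assumes "exp_growth f" "exp_growth g"
  shows "exp_growth (\<lambda>n. f n + g n)"
proof -
  obtain K L where KL: "K \<ge> 1" "\<And>n. n \<in> msets \<Longrightarrow> \<bar>f n\<bar> \<le> K ^ Suc (size n)"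
    "L \<ge> 1" "\<And>n. n \<in> msets \<Longrightarrow> \<bar>g n\<bar> \<le> L ^ Suc (size n)"
    using assms unfolding exp_growth_def by blast
  show ?thesis
  proof (rule exp_growthI[of "K + L"])
    fix n assume n: "n \<in> msets"
    have "\<bar>f n + g n\<bar> \<le> K ^ Suc (size n) + L ^ Suc (size n)"
      using KL(2)[OF n] KL(4)[OF n] by linarith
    also have "\<dots> \<le> (K + L) ^ Suc (size n)"
      using KL by (intro power_add_le_add_power) auto
    finally show "\<bar>f n + g n\<bar> \<le> (K + L) ^ Suc (size n)" .
  qed (use KL in simp)
qed

lemma exp_growth_cmult: "exp_growth g \<Longrightarrow> exp_growth (\<lambda>n. c * g n)"
  by (rule exp_growth_mult[OF exp_growth_const])

lemma exp_growth_diff: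
  "exp_growth f \<Longrightarrow> exp_growth g \<Longrightarrow> exp_growth (\<lambda>n. f n - g n)"
  using exp_growth_add[of f "\<lambda>n. -1 * g n"] exp_growth_cmult[of g "-1"] by simp

lemma exp_growth_sum:
  "finite J \<Longrightarrow> (\<And>j. j \<in> J \<Longrightarrow> exp_growth (f j)) \<Longrightarrow> exp_growth (\<lambda>n. \<Sum>j\<in>J. f j n)"
  by (induction J rule: finite_induct) (auto intro: exp_growth_const exp_growth_add)

lemma exp_growth_abs: "exp_growth g \<Longrightarrow> exp_growth (\<lambda>n. \<bar>g n\<bar>)"
  by (simp add: exp_growth_def)

lemma exp_growth_add_mset:
  assumes "exp_growth g" "r \<in> I"
  shows "exp_growth (\<lambda>n. g (add_mset r n))"
proof -
  obtain K where K: "K \<ge> 1" "\<And>n. n \<in> msets \<Longrightarrow> \<bar>g n\<bar> \<le> K ^ Suc (size n)"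
    using assms unfolding exp_growth_def by blast
  show ?thesis
  \<comment> \<open>Adding an element raises the exponent to \<open>size n + 2\<close>, which is at
    most \<open>2 * Suc (size n)\<close>; hence the squared constant.\<close>
  proof (rule exp_growthI[of "K ^ 2"])
    fix n assume "n \<in> msets"
    then have "\<bar>g (add_mset r n)\<bar> \<le> K ^ (size n + 2)"
      using K(2)[of "add_mset r n"] assms by (simp add: add_mset_in_msets)
    also have "\<dots> \<le> K ^ (2 * Suc (size n))" by (rule power_increasing) (use K in auto)
    finally show "\<bar>g (add_mset r n)\<bar> \<le> (K ^ 2) ^ Suc (size n)" by (simp only: power_mult)
  qed (use K in simp)
qed

lemma exp_growth_minus_mset:
  assumes "exp_growth g"
  shows "exp_growth (\<lambda>n. g (n - m))"
proof -
  obtain K where K: "K \<ge> 1" "\<And>n. n \<in> msets \<Longrightarrow> \<bar>g n\<bar> \<le> K ^ Suc (size n)"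
    using assms unfolding exp_growth_def by blast
  show ?thesis
  proof (rule exp_growthI[OF K(1)])
    fix n assume "n \<in> msets"
    then have "\<bar>g (n - m)\<bar> \<le> K ^ Suc (size (n - m))" by (intro K minus_in_msets)
    also have "\<dots> \<le> K ^ Suc (size n)"
      by (rule power_increasing) (use K in \<open>auto intro: size_mset_mono\<close>)
    finally show "\<bar>g (n - m)\<bar> \<le> K ^ Suc (size n)" .
  qed
qed

lemma exp_growth_diff_op: "exp_growth g \<Longrightarrow> exp_growth (diff_op p g)"
  unfolding diff_op_def
  by (intro exp_growth_sum finite_I exp_growth_cmult exp_growth_diff exp_growth_add_mset)

lemma exp_growth_creation_op: "exp_growth g \<Longrightarrow> exp_growth (creation_op p g)"
  unfolding creation_op_def divide_inverse
  by (intro exp_growth_sum finite_I exp_growth_cmult exp_growth_diff exp_growth_mult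
      exp_growth_count exp_growth_const exp_growth_minus_mset)

text \<open>The iterate sums over words of length \<open>m\<close>, and a multiset of size
  \<open>m\<close> arises from a multinomial number of words; multiplied by the powers of
  \<open>lam\<close> this is \<open>fact m * weight n\<close>. The induction replaces the word count
  by Mecke's formula.\<close>

lemma shift_sum_funpow_eq:
  "(shift_sum lam ^^ m) g {#} = fact m * (\<Sum>n | n \<in> msets \<and> size n = m. weight n * g n)"
proof (induction m arbitrary: g)
  case 0
  have "{n. n \<in> msets \<and> size n = 0} = {{#}}" by auto
  then show ?case by simp
next
  case (Suc m)
  \<comment> \<open>Cutting \<open>g\<close> off outside size \<open>Suc m\<close> turns finite sums
    into sums over \<open>msets\<close>, to which \<open>infsum_weight_count\<close>
    applies.\<close>
  define h where "h n = (if size n = Suc m then g n else 0)" for n :: "'i multiset"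
  have fin: "(\<Sum>\<^sub>\<infinity>n\<in>msets. if size n = j then f n else 0) = (\<Sum>n | n \<in> msets \<and> size n = j. f n)"
    for j and f :: "'i multiset \<Rightarrow> real"
  proof -
    have "(\<Sum>\<^sub>\<infinity>n\<in>msets. if size n = j then f n else 0) = (\<Sum>\<^sub>\<infinity>n | n \<in> msets \<and> size n = j. f n)"
      by (rule infsum_cong_neutral) auto
    then show ?thesis by (simp add: finite_msets_of_size)
  qed
  have "(\<Sum>n | n \<in> msets \<and> size n = m. weight n * shift_sum lam g n)
      = (\<Sum>r\<in>I. lam r * (\<Sum>n | n \<in> msets \<and> size n = m. weight n * g (add_mset r n)))"
    by (simp add: shift_sum_def sum_distrib_left sum.swap[of _ I] mult_ac)
  also have "\<dots> = (\<Sum>r\<in>I. lam r * (\<Sum>\<^sub>\<infinity>n\<in>msets. weight n * h (add_mset r n)))"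
    by (simp add: fin[symmetric] h_def if_distrib cong: if_cong)
  also have "\<dots> = (\<Sum>r\<in>I. \<Sum>\<^sub>\<infinity>n\<in>msets. weight n * (count n r * h n))"
  proof (rule sum.cong[OF refl])
    fix r assume r: "r \<in> I"
    \<comment> \<open>If \<open>r\<close> is in \<open>n\<close>, removing and restoring it changes
      nothing; otherwise the count is zero.\<close>
    have "weight n * (count n r * h n) = weight n * (count n r * h (add_mset r (n - {#r#})))" for n
      by (cases "r \<in># n") (auto simp: count_eq_zero_iff)
    then show "lam r * (\<Sum>\<^sub>\<infinity>n\<in>msets. weight n * h (add_mset r n))
        = (\<Sum>\<^sub>\<infinity>n\<in>msets. weight n * (count n r * h n))"
      using infsum_weight_count[OF r, of "\<lambda>n. h (add_mset r n)"] by (simp only:)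
  qed
  also have "\<dots> = (\<Sum>r\<in>I. \<Sum>n | n \<in> msets \<and> size n = Suc m. weight n * (count n r * g n))"
    by (simp add: fin[symmetric] h_def if_distrib cong: if_cong)
  also have "\<dots> = (\<Sum>n | n \<in> msets \<and> size n = Suc m. weight n * ((\<Sum>r\<in>I. real (count n r)) * g n))"
    by (simp add: sum_distrib_left sum_distrib_right sum.swap[of _ _ I] mult_ac)
  also have "\<dots> = (\<Sum>n | n \<in> msets \<and> size n = Suc m. weight n * (Suc m * g n))"
  proof (intro sum.cong refl)
    fix n assume "n \<in> {n. n \<in> msets \<and> size n = Suc m}"
    then have n: "set_mset n \<subseteq> I" "size n = Suc m" by (auto simp: msets_def)
    \<comment> \<open>The multiplicities add up to the size, which supplies the factor between
      \<open>fact m\<close> and \<open>fact (Suc m)\<close>.\<close>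
    have "(\<Sum>r\<in>I. count n r) = Suc m"
      using n finite_I unfolding n(2)[symmetric] size_multiset_overloaded_eq
      by (intro sum.mono_neutral_right) (auto simp: count_eq_zero_iff)
    then show "weight n * ((\<Sum>r\<in>I. real (count n r)) * g n) = weight n * (real (Suc m) * g n)"
      by (metis of_nat_sum)
  qed
  finally have "(\<Sum>n | n \<in> msets \<and> size n = m. weight n * shift_sum lam g n)
      = Suc m * (\<Sum>n | n \<in> msets \<and> size n = Suc m. weight n * g n)"
    by (simp add: sum_distrib_left mult_ac)
  then show ?case using Suc[of "shift_sum lam g"] by (simp add: funpow_swap1 mult_ac)
qed

lemma sum_weight_size:
  "(\<Sum>n | n \<in> msets \<and> size n = m. weight n) = sum lam I ^ m / fact m"
proof -
  have "(shift_sum lam ^^ m) (\<lambda>_. 1) n = sum lam I ^ m" for n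
    by (induction m arbitrary: n) (auto simp: shift_sum_def sum_distrib_right)
  then show ?thesis using shift_sum_funpow_eq[of m "\<lambda>_. 1"] by simp
qed

lemma sum_weight_power:
  "(\<Sum>n | n \<in> msets \<and> size n = m. weight n * K ^ size n) = (sum lam I * K) ^ m / fact m"
proof -
  have "(\<Sum>n | n \<in> msets \<and> size n = m. weight n * K ^ size n)
      = (\<Sum>n | n \<in> msets \<and> size n = m. weight n) * K ^ m"
    unfolding sum_distrib_right by (intro sum.cong) auto
  then show ?thesis by (simp add: sum_weight_size power_mult_distrib)
qed

text \<open>A finite set of multisets lies in finitely many size layers. By
  \<open>sum_weight_power\<close> these layers contribute a partial sum of an exponential series,
  which bounds all finite sums.\<close>

lemma summable_weight_power:
  assumes "K \<ge> 0"
  shows "(\<lambda>n. weight n * K ^ size n) summable_on msets"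
proof (rule nonneg_bdd_above_summable_on)
  show "bdd_above (sum (\<lambda>n. weight n * K ^ size n) ` {F. F \<subseteq> msets \<and> finite F})"
  proof (rule bdd_aboveI2)
    fix F assume F: "F \<in> {F. F \<subseteq> msets \<and> finite F}"
    define N where "N = Suc (Max (size ` F))"
    have N: "size n < N" if "n \<in> F" for n
      using F that by (auto simp: N_def less_Suc_eq_le)
    have "sum (\<lambda>n. weight n * K ^ size n) F
        \<le> sum (\<lambda>n. weight n * K ^ size n) (\<Union>m<N. {n \<in> msets. size n = m})"
    proof (rule sum_mono2)
      show "finite (\<Union>m<N. {n \<in> msets. size n = m})" by (simp add: finite_msets_of_size)
      show "F \<subseteq> (\<Union>m<N. {n \<in> msets. size n = m})" using F N by blast
    qed (simp add: assms weight_nonneg)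
    also have "\<dots> = (\<Sum>m<N. \<Sum>n | n \<in> msets \<and> size n = m. weight n * K ^ size n)"
      by (intro sum.UNION_disjoint) (auto simp: finite_msets_of_size)
    also have "\<dots> = (\<Sum>m<N. (sum lam I * K) ^ m / fact m)"
      by (simp only: sum_weight_power)
    also have "\<dots> \<le> (\<Sum>m. (sum lam I * K) ^ m / fact m)"
    proof (rule sum_le_suminf)
      show "summable (\<lambda>m. (sum lam I * K) ^ m / fact m)"
        using summable_exp[of "sum lam I * K"] by (simp add: divide_inverse mult.commute)
      have "sum lam I * K \<ge> 0"
        using assms lam_pos by (intro mult_nonneg_nonneg sum_nonneg) (auto intro: less_imp_le)
      then show "\<And>m. 0 \<le> (sum lam I * K) ^ m / fact m" by simp
    qed simp
    finally show "sum (\<lambda>n. weight n * K ^ size n) F \<le> (\<Sum>m. (sum lam I * K) ^ m / fact m)" .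
  qed
qed (simp add: assms weight_nonneg)

lemma summable_exp_growth:
  assumes "exp_growth g"
  shows "(\<lambda>n. weight n * g n) summable_on msets"
proof -
  obtain K where K: "K \<ge> 1" "\<And>n. n \<in> msets \<Longrightarrow> \<bar>g n\<bar> \<le> K ^ Suc (size n)"
    using assms unfolding exp_growth_def by blast
  have "(\<lambda>n. weight n * K ^ size n * K) summable_on msets"
    using summable_weight_power[of K] K by (intro summable_on_cmult_left) auto
  then have "(\<lambda>n. norm (weight n * K ^ size n * K)) summable_on msets"
    by (rule iffD1[OF summable_on_iff_abs_summable_on_real])
  then have "(\<lambda>n. norm (weight n * g n)) summable_on msets"
  proof (rule Infinite_Sum.abs_summable_on_comparison_test)
    fix n assume "n \<in> msets"
    then have "\<bar>g n\<bar> \<le> K ^ size n * K" using K(2) by (metis power_Suc2)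
    then have "weight n * \<bar>g n\<bar> \<le> weight n * (K ^ size n * K)"
      by (rule mult_left_mono[OF _ weight_nonneg])
    then show "norm (weight n * g n) \<le> norm (weight n * K ^ size n * K)"
      using K(1) weight_nonneg[of n] by (simp add: abs_mult mult.assoc)
  qed
  then show ?thesis by (rule iffD2[OF summable_on_iff_abs_summable_on_real])
qed

section \<open>Rules for the Poisson expectation\<close>

lemma expct_cong: "(\<And>n. n \<in> msets \<Longrightarrow> f n = g n) \<Longrightarrow> expct f = expct g"
  unfolding expct_def by (auto intro!: infsum_cong)

lemma expct_cmult: "expct (\<lambda>n. c * g n) = c * expct g"
proof -
  have "(\<lambda>n. weight n * (c * g n)) = (\<lambda>n. c * (weight n * g n))" by (auto simp: mult_ac)
  then show ?thesis by (simp add: expct_def infsum_cmult_right')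
qed

lemma expct_add:
  "exp_growth f \<Longrightarrow> exp_growth g \<Longrightarrow> expct (\<lambda>n. f n + g n) = expct f + expct g"
  unfolding expct_def by (simp add: distrib_left infsum_add summable_exp_growth)

lemma expct_diff:
  "exp_growth f \<Longrightarrow> exp_growth g \<Longrightarrow> expct (\<lambda>n. f n - g n) = expct f - expct g"
  using expct_add[of f "\<lambda>n. -1 * g n"] exp_growth_cmult[of g "-1"] expct_cmult[of "-1" g] by simp

lemma expct_sum:
  "finite J \<Longrightarrow> (\<And>j. j \<in> J \<Longrightarrow> exp_growth (f j)) \<Longrightarrow>
    expct (\<lambda>n. \<Sum>j\<in>J. f j n) = (\<Sum>j\<in>J. expct (f j))"
proof (induction J rule: finite_induct)
  case empty
  then show ?case using expct_cmult[of 0 "\<lambda>_. 0"] by simp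
next
  case (insert j J)
  then show ?case by (simp add: expct_add exp_growth_sum)
qed

lemma expct_mono:
  assumes "exp_growth f" "exp_growth g" "\<And>n. n \<in> msets \<Longrightarrow> f n \<le> g n"
  shows "expct f \<le> expct g"
  unfolding expct_def
  by (intro mult_left_mono infsum_mono summable_exp_growth assms) (auto simp: weight_nonneg)

text \<open>Summation layer by layer: multisets of fixed size form a finite set, and
  \<open>shift_sum_funpow_eq\<close> evaluates the sum over it.\<close>

lemma expct_sums:
  assumes "exp_growth g"
  shows "(\<lambda>m. (shift_sum lam ^^ m) g {#} / fact m) sums (exp (sum lam I) * expct g)"
proof -
  define B where "B m = {n \<in> msets. size n = m}" for m
  have bij: "bij_betw snd (Sigma UNIV B) msets"
    by (rule bij_betw_byWitness[of _ "\<lambda>n. (size n, n)"]) (auto simp: B_def)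
  have "((\<lambda>n. weight n * g n) has_sum (\<Sum>\<^sub>\<infinity>n\<in>msets. weight n * g n)) msets"
    using summable_exp_growth[OF assms] by (rule has_sum_infsum)
  then have "((\<lambda>x. weight (snd x) * g (snd x)) has_sum (\<Sum>\<^sub>\<infinity>n\<in>msets. weight n * g n)) (Sigma UNIV B)"
    by (simp add: has_sum_reindex_bij_betw[OF bij, of "\<lambda>n. weight n * g n"])
  then have "((\<lambda>m. \<Sum>n\<in>B m. weight n * g n) has_sum (\<Sum>\<^sub>\<infinity>n\<in>msets. weight n * g n)) UNIV"
    by (rule has_sum_SigmaD) (auto simp: B_def intro!: has_sum_finite finite_msets_of_size)
  then have "(\<lambda>m. \<Sum>n\<in>B m. weight n * g n) sums (\<Sum>\<^sub>\<infinity>n\<in>msets. weight n * g n)"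
    by (rule has_sum_imp_sums)
  moreover have "(\<Sum>n\<in>B m. weight n * g n) = (shift_sum lam ^^ m) g {#} / fact m" for m
    by (simp add: shift_sum_funpow_eq B_def)
  moreover have "exp (sum lam I) * expct g = (\<Sum>\<^sub>\<infinity>n\<in>msets. weight n * g n)"
    by (simp add: expct_def exp_minus)
  ultimately show ?thesis by simp
qed

lemma expct_const: "expct (\<lambda>_. c) = c"
proof -
  have "(shift_sum lam ^^ m) (\<lambda>_. 1) n = sum lam I ^ m" for n m
    by (induction m arbitrary: n) (auto simp: shift_sum_def sum_distrib_right)
  then have "(\<lambda>m. sum lam I ^ m / fact m) sums (exp (sum lam I) * expct (\<lambda>_. 1))"
    using expct_sums[OF exp_growth_const[of 1]] by simp
  moreover have "(\<lambda>m. sum lam I ^ m / fact m) sums exp (sum lam I)"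
    using exp_converges[of "sum lam I"] by (simp add: field_simps)
  ultimately have "exp (sum lam I) * expct (\<lambda>_. 1) = exp (sum lam I)"
    by (rule sums_unique2)
  then show ?thesis using expct_cmult[of c "\<lambda>_. 1"] by simp
qed

text \<open>With \<open>a\<close> the mean of the absolute value of \<open>g\<close>, this
  integrates the nonnegative square of the difference between that absolute value and
  \<open>a\<close>, using that the weights have total mass 1.\<close>

lemma expct_abs_le_sqrt:
  assumes "exp_growth g"
  shows "expct (\<lambda>n. \<bar>g n\<bar>) \<le> sqrt (expct (\<lambda>n. (g n)\<^sup>2))"
proof -
  define a where "a = expct (\<lambda>n. \<bar>g n\<bar>)"
  have g2: "exp_growth (\<lambda>n. (g n)\<^sup>2)"
    unfolding power2_eq_square using assms by (intro exp_growth_mult)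
  have ag: "exp_growth (\<lambda>n. 2 * a * \<bar>g n\<bar>)"
    using assms by (intro exp_growth_cmult exp_growth_abs)
  have "expct (\<lambda>n. 2 * a * \<bar>g n\<bar>) \<le> expct (\<lambda>n. (g n)\<^sup>2 + a\<^sup>2)"
  proof (rule expct_mono[OF ag exp_growth_add[OF g2 exp_growth_const]])
    fix n show "2 * a * \<bar>g n\<bar> \<le> (g n)\<^sup>2 + a\<^sup>2"
      using sum_squares_bound[of a "\<bar>g n\<bar>"] by (simp add: power2_eq_square)
  qed
  then have "2 * a * a \<le> expct (\<lambda>n. (g n)\<^sup>2) + a\<^sup>2"
    by (simp add: expct_add g2 exp_growth_const expct_const expct_cmult a_def[symmetric])
  then show ?thesis by (fold a_def, intro real_le_rsqrt) (simp add: power2_eq_square)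
qed

section \<open>The adjoint of the difference operator and their commutator\<close>

lemma expct_creation_op:
  assumes f: "exp_growth f" and g: "exp_growth g"
  shows "expct (\<lambda>n. creation_op p f n * g n) = expct (\<lambda>n. f n * diff_op p g n)"
proof -
  have *: "expct (\<lambda>n. f n * g (add_mset r n))
      = expct (\<lambda>n. count n r / lam r * f (n - {#r#}) * g n)" if r: "r \<in> I" for r
  proof -
    \<comment> \<open>Mecke's formula moves the removal of \<open>r\<close> in \<open>f\<close> to
      an addition of \<open>r\<close> in \<open>g\<close>. To fit its form, \<open>g n\<close> is
      rewritten as \<open>g\<close> at \<open>n\<close> with \<open>r\<close> removed and restored,
      valid whenever the count is nonzero.\<close>
    have "expct (\<lambda>n. count n r / lam r * f (n - {#r#}) * g n)
        = expct (\<lambda>n. 1 / lam r * (count n r * (f (n - {#r#}) * g (add_mset r (n - {#r#})))))"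
    proof (rule expct_cong)
      fix n show "count n r / lam r * f (n - {#r#}) * g n
          = 1 / lam r * (count n r * (f (n - {#r#}) * g (add_mset r (n - {#r#}))))"
        by (cases "r \<in># n") (auto simp: count_eq_zero_iff)
    qed
    also have "\<dots> = expct (\<lambda>n. f n * g (add_mset r n))"
      using expct_count[OF r, of "\<lambda>n. f n * g (add_mset r n)"] lam_pos[OF r]
      unfolding expct_cmult by simp
    finally show ?thesis by simp
  qed
  note intros = exp_growth_mult exp_growth_count exp_growth_const exp_growth_minus_mset
      exp_growth_add_mset f g
  define h where "h r n = count n r / lam r * f (n - {#r#}) * g n" for r n
  have fr: "exp_growth (\<lambda>n. f n * g (add_mset r n))" if "r \<in> I" for r
    using that by (intro intros)
  have gr: "exp_growth (h r)" for r
    unfolding h_def divide_inverse by (intro intros)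
  have "expct (\<lambda>n. creation_op p f n * g n)
      = expct (\<lambda>n. \<Sum>r\<in>I. p r * (h r n - f n * g n))"
    unfolding creation_op_def sum_distrib_right h_def by (simp add: algebra_simps)
  also have "\<dots> = (\<Sum>r\<in>I. p r * (expct (h r) - expct (\<lambda>n. f n * g n)))"
    by (subst expct_sum)
      (auto simp: expct_cmult expct_diff gr exp_growth_mult[OF f g] finite_I
        intro!: exp_growth_cmult exp_growth_diff)
  also have "\<dots> = (\<Sum>r\<in>I. p r * (expct (\<lambda>n. f n * g (add_mset r n)) - expct (\<lambda>n. f n * g n)))"
    by (simp add: * h_def[abs_def])
  also have "\<dots> = expct (\<lambda>n. \<Sum>r\<in>I. p r * (f n * g (add_mset r n) - f n * g n))"
    by (subst expct_sum)
      (auto simp: expct_cmult expct_diff fr exp_growth_mult[OF f g] finite_I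
        intro!: exp_growth_cmult exp_growth_diff)
  also have "\<dots> = expct (\<lambda>n. f n * diff_op p g n)"
    by (simp add: diff_op_def sum_distrib_left algebra_simps)
  finally show ?thesis .
qed

text \<open>Adding \<open>s\<close> changes the multiplicity of \<open>r\<close> only if
  \<open>r = s\<close>. This diagonal contribution is the scalar \<open>inner_lam p q\<close>; in
  all other respects addition and removal commute.\<close>

lemma diff_op_creation_op:
  "diff_op q (creation_op p g) n = creation_op p (diff_op q g) n + inner_lam p q * g n"
proof -
  define c where "c r m = count m r / lam r * g (m - {#r#}) - g m" for r m
  have c: "creation_op p g m = (\<Sum>r\<in>I. p r * c r m)" for m
    by (simp add: creation_op_def c_def)
  have "diff_op q (creation_op p g) n = (\<Sum>s\<in>I. \<Sum>r\<in>I. q s * p r * (c r (add_mset s n) - c r n))"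
    unfolding diff_op_def c by (simp add: sum_subtractf[symmetric] sum_distrib_left algebra_simps)
  also have "\<dots> = (\<Sum>s\<in>I. \<Sum>r\<in>I. q s * p r * (count n r / lam r *
      (g (add_mset s (n - {#r#})) - g (n - {#r#})) - (g (add_mset s n) - g n))
      + (if r = s then p r * q r / lam r * g n else 0))"
  proof (intro sum.cong refl)
    fix s r assume r: "r \<in> I"
    show "q s * p r * (c r (add_mset s n) - c r n) = q s * p r * (count n r / lam r *
      (g (add_mset s (n - {#r#})) - g (n - {#r#})) - (g (add_mset s n) - g n))
      + (if r = s then p r * q r / lam r * g n else 0)"
    \<comment> \<open>Truncated subtraction commutes with adding \<open>s\<close> only if
      \<open>r\<close> is present. If it is absent, the removal terms vanish, except that for
      \<open>r = s\<close> the new element has count 1 and its removal gives back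
      \<open>n\<close>.\<close>
    proof (cases "r \<in># n")
      case True
      then have "add_mset s n - {#r#} = add_mset s (n - {#r#})" "add_mset r (n - {#r#}) = n"
        by simp_all
      then show ?thesis
        by (cases "r = s") (simp_all add: c_def algebra_simps add_divide_distrib)
    next
      case False
      then have "count n r = 0" by (simp add: count_eq_zero_iff)
      then show ?thesis by (cases "r = s") (simp_all add: c_def algebra_simps)
    qed
  qed
  also have "\<dots> = (\<Sum>r\<in>I. \<Sum>s\<in>I. q s * p r * (count n r / lam r *
      (g (add_mset s (n - {#r#})) - g (n - {#r#})) - (g (add_mset s n) - g n)))
      + (\<Sum>s\<in>I. p s * q s / lam s * g n)"
    by (subst sum.swap) (simp add: sum.distrib finite_I)
  also have "(\<Sum>s\<in>I. p s * q s / lam s * g n) = inner_lam p q * g n"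
    by (simp add: inner_lam_def sum_distrib_right)
  also have "(\<Sum>r\<in>I. \<Sum>s\<in>I. q s * p r * (count n r / lam r *
      (g (add_mset s (n - {#r#})) - g (n - {#r#})) - (g (add_mset s n) - g n)))
      = creation_op p (diff_op q g) n"
    unfolding creation_op_def diff_op_def
    by (simp add: sum_subtractf[symmetric] sum_distrib_left algebra_simps)
  finally show ?thesis .
qed

lemma creation_op_sum:
  "creation_op p (\<lambda>n. \<Sum>x\<in>S. c x * f x n) n = (\<Sum>x\<in>S. c x * creation_op p (f x) n)"
  unfolding creation_op_def sum_distrib_left sum_subtractf[symmetric]
  by (subst sum.swap) (simp add: algebra_simps)

section \<open>Charlier polynomials and their inner products\<close>

lemma inner_lam_commute: "inner_lam p q = inner_lam q p"
  by (simp add: inner_lam_def mult.commute)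

text \<open>For a single index and all coefficients equal to 1, this is the classical Charlier
  polynomial of degree \<open>length us\<close> up to the sign (-1)^(length us).\<close>

definition charlier :: "('i \<Rightarrow> real) list \<Rightarrow> 'i multiset \<Rightarrow> real" where
  "charlier us = foldr creation_op us (\<lambda>_. 1)"

lemma charlier_simps [simp]:
  "charlier [] = (\<lambda>_. 1)" "charlier (u # us) = creation_op u (charlier us)"
  by (simp_all add: charlier_def)

lemma exp_growth_charlier: "exp_growth (charlier us)"
  by (induction us) (auto intro: exp_growth_const exp_growth_creation_op)

text \<open>The head of \<open>us\<close> is the outermost creation operator, so its adjoint reaches
  \<open>g\<close> first; this is the order of \<open>fold\<close>.\<close>

lemma expct_charlier_eq_diff_op:
  "exp_growth g \<Longrightarrow> expct (\<lambda>n. charlier us n * g n) = expct (fold diff_op us g)"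
  by (induction us arbitrary: g)
    (simp_all add: expct_creation_op exp_growth_charlier exp_growth_diff_op)

text \<open>A Leibniz rule: commuting the difference past each creation operator leaves a scalar
  times the product without that factor, and the constant 1 is annihilated at the end. Distinct
  labels \<open>xs\<close> keep factors apart even when \<open>v\<close> takes equal values on
  them.\<close>

lemma diff_op_charlier:
  "distinct xs \<Longrightarrow> diff_op q (charlier (map v xs)) n
    = (\<Sum>x\<in>set xs. inner_lam (v x) q * charlier (map v (remove1 x xs)) n)"
proof (induction xs arbitrary: n)
  case Nil
  then show ?case by (simp add: diff_op_def)
next
  case (Cons y xs)
  have "diff_op q (charlier (map v (y # xs))) n
      = creation_op (v y) (diff_op q (charlier (map v xs))) n
        + inner_lam (v y) q * charlier (map v xs) n"
    by (simp add: diff_op_creation_op)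
  also have "diff_op q (charlier (map v xs))
      = (\<lambda>n. \<Sum>x\<in>set xs. inner_lam (v x) q * charlier (map v (remove1 x xs)) n)"
    using Cons by auto
  \<comment> \<open>As \<open>y\<close> differs from every \<open>x\<close> in \<open>xs\<close>,
    the operator for \<open>y\<close> restores the head of
    \<open>remove1 x (y # xs)\<close>.\<close>
  also have "creation_op (v y) \<dots> n
      = (\<Sum>x\<in>set xs. inner_lam (v x) q * charlier (map v (remove1 x (y # xs))) n)"
    using Cons.prems unfolding creation_op_sum by (intro sum.cong) auto
  finally show ?case using Cons.prems by simp
qed

text \<open>Each creation operator of the first factor acts as a difference on the second and pairs
  with one of its labels. Repeating this exhausts both lists, so the complete pairings remain, coded
  as orderings \<open>zs\<close> of the labels.\<close>

lemma expct_charlier_mult: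
  "distinct xs \<Longrightarrow> length us = length xs \<Longrightarrow>
    expct (\<lambda>n. charlier us n * charlier (map v xs) n)
      = (\<Sum>zs\<in>permutations_of_set (set xs). prod_list (map2 inner_lam us (map v zs)))"
proof (induction us arbitrary: xs)
  case Nil
  then show ?case by (simp add: expct_const)
next
  case (Cons u us)
  have ne: "set xs \<noteq> {}" using Cons.prems by auto
  have "expct (\<lambda>n. charlier (u # us) n * charlier (map v xs) n)
      = expct (\<lambda>n. charlier us n * diff_op u (charlier (map v xs)) n)"
    by (simp add: expct_creation_op exp_growth_charlier)
  also have "\<dots> = expct (\<lambda>n. \<Sum>x\<in>set xs. inner_lam u (v x) *
      (charlier us n * charlier (map v (remove1 x xs)) n))"
    unfolding diff_op_charlier[OF Cons.prems(1)] sum_distrib_left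
    by (simp add: mult_ac inner_lam_commute[of u])
  also have "\<dots> = (\<Sum>x\<in>set xs. inner_lam u (v x) *
      expct (\<lambda>n. charlier us n * charlier (map v (remove1 x xs)) n))"
    by (subst expct_sum)
      (auto simp: expct_cmult intro!: exp_growth_cmult exp_growth_mult exp_growth_charlier)
  also have "\<dots> = (\<Sum>x\<in>set xs. inner_lam u (v x) *
      (\<Sum>zs\<in>permutations_of_set (set xs - {x}). prod_list (map2 inner_lam us (map v zs))))"
  proof (intro sum.cong refl)
    fix x assume "x \<in> set xs"
    then have "distinct (remove1 x xs)" "length us = length (remove1 x xs)"
      using Cons.prems by (auto simp: length_remove1)
    then show "inner_lam u (v x) * expct (\<lambda>n. charlier us n * charlier (map v (remove1 x xs)) n)
        = inner_lam u (v x) * (\<Sum>zs\<in>permutations_of_set (set xs - {x}).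
            prod_list (map2 inner_lam us (map v zs)))"
      using Cons.IH[of "remove1 x xs"] Cons.prems by simp
  qed
  \<comment> \<open>The label paired with \<open>u\<close> becomes the first entry of the ordering,
    matching the recursion for \<open>permutations_of_set\<close>.\<close>
  also have "\<dots> = (\<Sum>x\<in>set xs. \<Sum>zs\<in>(#) x ` permutations_of_set (set xs - {x}).
      prod_list (map2 inner_lam (u # us) (map v zs)))"
    by (simp add: sum_distrib_left sum.reindex)
  also have "\<dots> = (\<Sum>zs\<in>permutations_of_set (set xs). prod_list (map2 inner_lam (u # us) (map v zs)))"
    unfolding permutations_of_set_nonempty[OF ne]
    by (subst sum.UNION_disjoint) auto
  finally show ?case .
qed

section \<open>Iterated differences under shifts and integrals\<close>

lemma fold_diff_op_cong:
  "(\<And>m. m \<in> msets \<Longrightarrow> f m = g m) \<Longrightarrow> n \<in> msets \<Longrightarrow> fold diff_op us f n = fold diff_op us g n"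
proof (induction us arbitrary: f g)
  case (Cons u us)
  \<comment> \<open>Starting in \<open>msets\<close>, the operator evaluates only at points of
    \<open>msets\<close>.\<close>
  have "diff_op u f m = diff_op u g m" if "m \<in> msets" for m
    using Cons.prems(1) that unfolding diff_op_def by (intro sum.cong) (auto simp: add_mset_in_msets)
  then show ?case using Cons.IH[of "diff_op u f" "diff_op u g"] Cons.prems(2) by simp
qed simp

lemma fold_diff_op_shift:
  "fold diff_op us (\<lambda>m. f (m + k)) n = fold diff_op us f (n + k)"
proof (induction us arbitrary: f)
  case (Cons u us)
  have "diff_op u (\<lambda>m. f (m + k)) = (\<lambda>m. diff_op u f (m + k))"
    by (simp add: diff_op_def fun_eq_iff)
  then show ?case using Cons.IH[of "diff_op u f"] by simp
qed simp

lemma measurable_fold_diff_op: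
  "(\<And>m. (\<lambda>x. F x m) \<in> borel_measurable M) \<Longrightarrow> (\<lambda>x. fold diff_op us (F x) n) \<in> borel_measurable M"
proof (induction us arbitrary: F)
  case (Cons u us)
  have "(\<lambda>x. diff_op u (F x) m) \<in> borel_measurable M" for m
    unfolding diff_op_def using Cons.prems by measurable
  then show ?case using Cons.IH[of "\<lambda>x. diff_op u (F x)"] by simp
qed simp

text \<open>Each difference is a finite linear combination of evaluations, hence commutes with
  integration over the parameter.\<close>

lemma fold_diff_op_integral:
  fixes F :: "'x \<Rightarrow> 'i multiset \<Rightarrow> real"
  shows "(\<And>m. integrable Q (\<lambda>x. F x m)) \<Longrightarrow>
    fold diff_op us (\<lambda>m. LINT x|Q. F x m) n = (LINT x|Q. fold diff_op us (F x) n)"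
proof (induction us arbitrary: F)
  case (Cons u us)
  have "integrable Q (\<lambda>x. diff_op u (F x) m)" for m
    unfolding diff_op_def using Cons.prems by auto
  moreover have "diff_op u (\<lambda>m. LINT x|Q. F x m) = (\<lambda>m. LINT x|Q. diff_op u (F x) m)"
    unfolding diff_op_def using Cons.prems by (auto simp: fun_eq_iff)
  ultimately show ?case using Cons.IH[of "\<lambda>x. diff_op u (F x)"] by simp
qed simp

section \<open>The exponential of the difference operator\<close>

lemma abs_shift_sum_le:
  assumes "\<And>n. \<bar>f n\<bar> \<le> C"
  shows "\<bar>shift_sum p f n\<bar> \<le> (\<Sum>r\<in>I. \<bar>p r\<bar>) * C"
  unfolding shift_sum_def sum_distrib_right
  using assms by (intro order_trans[OF sum_abs sum_mono]) (auto simp: abs_mult intro!: mult_left_mono)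

lemma diff_op_eq_shift_sum: "diff_op p f n = shift_sum p f n - sum p I * f n"
  by (simp add: diff_op_def shift_sum_def right_diff_distrib sum_subtractf sum_distrib_right)

text \<open>The bound is uniform in the parameter \<open>x\<close>; with \<open>x\<close> the
  translation variable, it supplies the boundedness required of integrands for signed
  measures.\<close>

lemma fold_diff_op_bounded:
  "(\<And>x m. \<bar>F x m\<bar> \<le> C) \<Longrightarrow> \<exists>B. \<forall>x n. \<bar>fold diff_op us (F x) n\<bar> \<le> B"
proof (induction us arbitrary: F C)
  case (Cons u us)
  have "\<bar>diff_op u (F x) m\<bar> \<le> (\<Sum>r\<in>I. \<bar>u r\<bar>) * C + \<bar>sum u I\<bar> * C" for x m
    using abs_shift_sum_le[of "F x" C u m, OF Cons.prems] Cons.prems[of x m]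
      mult_left_mono[of "\<bar>F x m\<bar>" C "\<bar>sum u I\<bar>"]
    unfolding diff_op_eq_shift_sum by (simp add: abs_mult[symmetric])
  from Cons.IH[OF this] show ?case by simp
qed auto

text \<open>The binomial theorem for \<open>shift_sum p\<close> minus the scalar
  \<open>sum p I\<close>, two commuting operators.\<close>

lemma diff_op_funpow_eq:
  "(diff_op p ^^ m) f n = (\<Sum>i\<le>m. of_nat (m choose i) * (- sum p I) ^ (m - i) * (shift_sum p ^^ i) f n)"
proof (induction m arbitrary: f)
  case (Suc m)
  define y where "y = - sum p I"
  define s where "s i = (shift_sum p ^^ i) f n" for i
  have lin: "(shift_sum p ^^ i) (diff_op p f) n = s (Suc i) + y * s i" for i
  proof -
    have "(shift_sum p ^^ i) (\<lambda>m. g m + c * h m) k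
        = (shift_sum p ^^ i) g k + c * (shift_sum p ^^ i) h k" for g h c k
      by (induction i arbitrary: k)
        (simp_all add: shift_sum_def sum.distrib sum_distrib_left distrib_left mult_ac)
    from this[of "shift_sum p f" y f n] show ?thesis
      by (simp add: diff_op_eq_shift_sum[abs_def] y_def s_def funpow_swap1)
  qed
  have "(diff_op p ^^ Suc m) f n = (\<Sum>i\<le>m. of_nat (m choose i) * y ^ (m - i) * (s (Suc i) + y * s i))"
    using Suc.IH[of "diff_op p f"] by (simp add: funpow_swap1 lin y_def)
  also have "\<dots> = (\<Sum>i\<le>m. of_nat (m choose i) * y ^ (m - i) * s (Suc i))
      + (\<Sum>i\<le>m. of_nat (m choose i) * y ^ (Suc m - i) * s i)"
    by (simp add: sum.distrib distrib_left Suc_diff_le mult_ac)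
  \<comment> \<open>The added term \<open>i = Suc m\<close> has binomial coefficient 0. Splitting
    off \<open>i = 0\<close> then aligns both sums for Pascal's rule.\<close>
  also have "(\<Sum>i\<le>m. of_nat (m choose i) * y ^ (Suc m - i) * s i)
      = (\<Sum>i\<le>Suc m. of_nat (m choose i) * y ^ (Suc m - i) * s i)"
    by simp
  also have "\<dots> = y ^ Suc m * s 0 + (\<Sum>i\<le>m. of_nat (m choose Suc i) * y ^ (m - i) * s (Suc i))"
    by (subst sum.atMost_Suc_shift) simp
  also have "(\<Sum>i\<le>m. of_nat (m choose i) * y ^ (m - i) * s (Suc i))
      + (y ^ Suc m * s 0 + (\<Sum>i\<le>m. of_nat (m choose Suc i) * y ^ (m - i) * s (Suc i)))
      = (\<Sum>i\<le>Suc m. of_nat (Suc m choose i) * y ^ (Suc m - i) * s i)"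
    by (subst sum.atMost_Suc_shift) (simp add: sum.distrib distrib_right)
  finally show ?case by (simp only: y_def s_def)
qed simp

text \<open>Since \<open>diff_op lam = shift_sum lam - L\<close> for the scalar \<open>L = sum lam I\<close>, its exponential is that of
  \<open>shift_sum lam\<close> times \<open>exp (- L)\<close>; evaluating at the empty multiset gives the series.\<close>

lemma diff_op_exp_sums:
  assumes "\<And>n. \<bar>f n\<bar> \<le> C"
  shows "(\<lambda>m. (diff_op lam ^^ m) f {#} / fact m) sums expct f"
proof -
  define L where "L = sum lam I"
  define a where "a i = (shift_sum lam ^^ i) f {#} / fact i" for i
  define b where "b j = (- L) ^ j / fact j" for j
  have f: "exp_growth f" using assms by (rule exp_growth_bounded)
  have L: "(\<Sum>r\<in>I. \<bar>lam r\<bar>) = L"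
    unfolding L_def by (intro sum.cong) (simp_all add: abs_of_pos lam_pos)
  have "\<bar>(shift_sum lam ^^ i) f n\<bar> \<le> L ^ i * C" for i n
  proof (induction i arbitrary: n)
    case (Suc i)
    then show ?case using abs_shift_sum_le[of "(shift_sum lam ^^ i) f" "L ^ i * C" lam n] by (simp add: L mult.assoc)
  qed (use assms in simp)
  then have "norm (a i) \<le> L ^ i / fact i * C" for i
    unfolding a_def using divide_right_mono[of "\<bar>(shift_sum lam ^^ i) f {#}\<bar>" "L ^ i * C" "fact i"] by simp
  moreover have exps: "(\<lambda>i. x ^ i / fact i) sums exp x" for x :: real
    using exp_converges[of x] by (simp add: divide_inverse mult.commute)
  ultimately have "summable (\<lambda>i. norm (a i))"
    using summable_mult2[OF sums_summable[OF exps[of L]], of C]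
    by (intro summable_comparison_test[of "\<lambda>i. norm (a i)" "\<lambda>i. L ^ i / fact i * C"]) auto
  moreover have "summable (\<lambda>j. norm (b j))"
    using sums_summable[OF exps[of "\<bar>L\<bar>"]] by (simp add: b_def power_abs)
  \<comment> \<open>Both series converge absolutely, so their product is the Cauchy product, whose
    terms are the binomial expansions of \<open>diff_op lam ^^ m\<close> divided by
    \<open>fact m\<close>.\<close>
  ultimately have "(\<lambda>m. \<Sum>i\<le>m. a i * b (m - i)) sums (suminf a * suminf b)"
    by (rule Cauchy_product_sums)
  moreover have "suminf a = exp L * expct f"
    using expct_sums[OF f] unfolding a_def L_def by (simp add: sums_iff)
  moreover have "suminf b = exp (- L)"
    using exps[of "- L"] unfolding b_def by (simp add: sums_iff)
  moreover have "(\<Sum>i\<le>m. a i * b (m - i)) = (diff_op lam ^^ m) f {#} / fact m" for m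
    unfolding diff_op_funpow_eq a_def b_def sum_divide_distrib L_def
    by (intro sum.cong) (auto simp: binomial_fact field_simps)
  moreover have "exp L * expct f * exp (- L) = expct f" by (simp add: exp_minus)
  ultimately show ?thesis by simp
qed

end

section \<open>Permanents and sums over index tuples\<close>

lemma bij_betw_permutes_permutations_of_set:
  assumes "distinct xs"
  shows "bij_betw (\<lambda>l. map l xs) {l. l permutes set xs} (permutations_of_set (set xs))"
proof -
  have inj: "inj_on (\<lambda>l. map l xs) {l. l permutes set xs}"
  proof (rule inj_onI)
    fix l m assume lm: "l \<in> {l. l permutes set xs}" "m \<in> {l. l permutes set xs}" "map l xs = map m xs"
    show "l = m"
    proof
      fix x show "l x = m x"
        using lm by (cases "x \<in> set xs") (auto simp: permutes_not_in)
    qed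
  qed
  have "(\<lambda>l. map l xs) ` {l. l permutes set xs} \<subseteq> permutations_of_set (set xs)"
    using assms by (auto simp: permutes_image distinct_map permutes_inj_on intro!: permutations_of_setI)
  \<comment> \<open>Both sets have \<open>fact (card (set xs))\<close> elements, so the inclusion of
    the image is an equality.\<close>
  moreover have "card ((\<lambda>l. map l xs) ` {l. l permutes set xs}) = card (permutations_of_set (set xs))"
    using card_image[OF inj] card_permutations[OF refl, of "set xs"] by simp
  ultimately have "(\<lambda>l. map l xs) ` {l. l permutes set xs} = permutations_of_set (set xs)"
    by (intro card_subset_eq) auto
  then show ?thesis using inj by (simp add: bij_betw_def)
qed

text \<open>The pairing formula with both lists equal, orderings being read as permutations: the
  second moment is the permanent of the Gram matrix of \<open>inner_lam\<close>.\<close>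

lemma (in multi_poisson) expct_charlier_square:
  assumes "distinct xs"
  shows "expct (\<lambda>n. (charlier (map p xs) n)\<^sup>2)
    = (\<Sum>l | l permutes set xs. \<Prod>j\<in>set xs. inner_lam (p j) (p (l j)))"
proof -
  have "expct (\<lambda>n. (charlier (map p xs) n)\<^sup>2)
      = (\<Sum>zs\<in>permutations_of_set (set xs). prod_list (map2 inner_lam (map p xs) (map p zs)))"
    unfolding power2_eq_square using assms by (intro expct_charlier_mult) auto
  also have "\<dots> = (\<Sum>l | l permutes set xs. prod_list (map2 inner_lam (map p xs) (map p (map l xs))))"
    by (rule sum.reindex_bij_betw[OF bij_betw_permutes_permutations_of_set[OF assms], symmetric])
  also have "\<dots> = (\<Sum>l | l permutes set xs. \<Prod>j\<in>set xs. inner_lam (p j) (p (l j)))"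
  proof (intro sum.cong refl)
    fix l
    have "map2 inner_lam (map p ys) (map p (map l ys)) = map (\<lambda>j. inner_lam (p j) (p (l j))) ys" for ys
      by (induction ys) auto
    then show "prod_list (map2 inner_lam (map p xs) (map p (map l xs)))
        = (\<Prod>j\<in>set xs. inner_lam (p j) (p (l j)))"
      using prod.distinct_set_conv_list[OF assms] by metis
  qed
  finally show ?thesis .
qed

text \<open>Reindexing each product by the inverse permutation makes factor \<open>i\<close> depend
  on \<open>r i\<close> alone, so the sum over tuples factorises.\<close>

lemma sum_PiE_prod_permutes:
  fixes a :: "'j \<Rightarrow> 'i \<Rightarrow> real"
  assumes "finite J" "finite I" "l permutes J" "m permutes J"
  shows "(\<Sum>r\<in>J \<rightarrow>\<^sub>E I. (\<Prod>j\<in>J. a j (r (l j))) * (\<Prod>j\<in>J. a j (r (m j))))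
    = (\<Prod>j\<in>J. \<Sum>s\<in>I. a j s * a (inv m (l j)) s)"
proof -
  have inv: "(\<Prod>j\<in>J. a j (r (l j))) = (\<Prod>i\<in>J. a (inv l i) (r i))" if "l permutes J" for l r
    using prod.permute[OF that, of "\<lambda>i. a (inv l i) (r i)"] permutes_inverses[OF that]
    by (simp add: o_def)
  have "(\<Sum>r\<in>J \<rightarrow>\<^sub>E I. (\<Prod>j\<in>J. a j (r (l j))) * (\<Prod>j\<in>J. a j (r (m j))))
      = (\<Sum>r\<in>J \<rightarrow>\<^sub>E I. \<Prod>i\<in>J. a (inv l i) (r i) * a (inv m i) (r i))"
    by (simp add: inv assms prod.distrib)
  also have "\<dots> = (\<Prod>i\<in>J. \<Sum>s\<in>I. a (inv l i) s * a (inv m i) s)"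
    using assms by (intro prod_sum_PiE[symmetric]) auto
  \<comment> \<open>Substituting \<open>i = l j\<close> turns \<open>inv l i\<close> into
    \<open>j\<close>.\<close>
  also have "\<dots> = (\<Prod>j\<in>J. \<Sum>s\<in>I. a j s * a (inv m (l j)) s)"
    using prod.permute[OF assms(3), of "\<lambda>i. \<Sum>s\<in>I. a (inv l i) s * a (inv m i) s"]
      permutes_inverses[OF assms(3)] by (simp add: o_def)
  finally show ?thesis .
qed

text \<open>Expanding the square gives a double sum over permutations. For fixed \<open>l\<close>,
  the relative permutation \<open>inv m o l\<close> runs through all permutations as
  \<open>m\<close> does, so every \<open>l\<close> contributes the same and their number is the
  factorial.\<close>

lemma sum_PiE_permanent_square:
  fixes a :: "'j \<Rightarrow> 'i \<Rightarrow> real"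
  assumes "finite J" "finite I"
  shows "(\<Sum>r\<in>J \<rightarrow>\<^sub>E I. (\<Sum>l | l permutes J. \<Prod>j\<in>J. a j (r (l j)))\<^sup>2)
    = fact (card J) * (\<Sum>l | l permutes J. \<Prod>j\<in>J. \<Sum>s\<in>I. a j s * a (l j) s)"
proof -
  have "(\<Sum>r\<in>J \<rightarrow>\<^sub>E I. (\<Sum>l | l permutes J. \<Prod>j\<in>J. a j (r (l j)))\<^sup>2)
      = (\<Sum>l | l permutes J. \<Sum>m | m permutes J. \<Sum>r\<in>J \<rightarrow>\<^sub>E I.
          (\<Prod>j\<in>J. a j (r (l j))) * (\<Prod>j\<in>J. a j (r (m j))))"
    unfolding power2_eq_square sum_product
    by (subst sum.swap) (rule sum.cong[OF refl], rule sum.swap)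
  also have "\<dots> = (\<Sum>l | l permutes J. \<Sum>m | m permutes J.
      \<Prod>j\<in>J. \<Sum>s\<in>I. a j s * a (inv m (l j)) s)"
    using assms by (intro sum.cong refl sum_PiE_prod_permutes) auto
  also have "\<dots> = (\<Sum>l | l permutes J. \<Sum>m | m permutes J.
      \<Prod>j\<in>J. \<Sum>s\<in>I. a j s * a (m j) s)"
  proof (rule sum.cong[OF refl])
    fix l assume "l \<in> {l. l permutes J}"
    then have l: "l permutes J" by simp
    have "(\<Sum>m | m permutes J. \<Prod>j\<in>J. \<Sum>s\<in>I. a j s * a (inv m (l j)) s)
        = (\<Sum>m | m permutes J. \<Prod>j\<in>J. \<Sum>s\<in>I. a j s * a (m (l j)) s)"
      by (rule sum_permutations_inverse[symmetric])
    also have "\<dots> = (\<Sum>m | m permutes J. \<Prod>j\<in>J. \<Sum>s\<in>I. a j s * a (m j) s)"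
      using sum_permutations_compose_right[OF l, of "\<lambda>m. \<Prod>j\<in>J. \<Sum>s\<in>I. a j s * a (m j) s"]
      by simp
    finally show "(\<Sum>m | m permutes J. \<Prod>j\<in>J. \<Sum>s\<in>I. a j s * a (inv m (l j)) s)
        = (\<Sum>m | m permutes J. \<Prod>j\<in>J. \<Sum>s\<in>I. a j s * a (m j) s)" .
  qed
  also have "\<dots> = fact (card J) * (\<Sum>l | l permutes J. \<Prod>j\<in>J. \<Sum>s\<in>I. a j s * a (l j) s)"
    using card_permutations[OF refl assms(1)] by simp
  finally show ?thesis .
qed

text \<open>Cauchy-Schwarz against the constant 1 yields one factorial. The surviving squares are
  the case \<open>m = l\<close> of \<open>sum_PiE_prod_permutes\<close>, equal for all
  \<open>l\<close>, and their number yields the other.\<close>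

lemma sum_PiE_permanent_square_le:
  fixes a :: "'j \<Rightarrow> 'i \<Rightarrow> real"
  assumes "finite J" "finite I"
  shows "(\<Sum>r\<in>J \<rightarrow>\<^sub>E I. (\<Sum>l | l permutes J. \<Prod>j\<in>J. a j (r (l j)))\<^sup>2)
    \<le> (fact (card J))\<^sup>2 * (\<Prod>j\<in>J. \<Sum>s\<in>I. (a j s)\<^sup>2)"
proof -
  have "(\<Sum>r\<in>J \<rightarrow>\<^sub>E I. (\<Sum>l | l permutes J. \<Prod>j\<in>J. a j (r (l j)))\<^sup>2)
      \<le> (\<Sum>r\<in>J \<rightarrow>\<^sub>E I. fact (card J) * (\<Sum>l | l permutes J. (\<Prod>j\<in>J. a j (r (l j)))\<^sup>2))"
  proof (rule sum_mono)
    fix r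
    show "(\<Sum>l | l permutes J. \<Prod>j\<in>J. a j (r (l j)))\<^sup>2
        \<le> fact (card J) * (\<Sum>l | l permutes J. (\<Prod>j\<in>J. a j (r (l j)))\<^sup>2)"
      using Cauchy_Schwarz_ineq_sum[of "\<lambda>_. 1" "\<lambda>l. \<Prod>j\<in>J. a j (r (l j))" "{l. l permutes J}"]
        card_permutations[OF refl assms(1)] by simp
  qed
  also have "\<dots> = fact (card J) * (\<Sum>l | l permutes J. \<Sum>r\<in>J \<rightarrow>\<^sub>E I. (\<Prod>j\<in>J. a j (r (l j)))\<^sup>2)"
    unfolding sum_distrib_left[symmetric] by (subst sum.swap) simp
  also have "\<dots> = fact (card J) * (\<Sum>l | l permutes J. \<Prod>j\<in>J. \<Sum>s\<in>I. (a j s)\<^sup>2)"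
  proof (intro arg_cong[where f = "(*) _"] sum.cong[OF refl])
    fix l assume "l \<in> {l. l permutes J}"
    then have l: "l permutes J" by simp
    show "(\<Sum>r\<in>J \<rightarrow>\<^sub>E I. (\<Prod>j\<in>J. a j (r (l j)))\<^sup>2) = (\<Prod>j\<in>J. \<Sum>s\<in>I. (a j s)\<^sup>2)"
      using sum_PiE_prod_permutes[OF assms l l, of a]
      by (simp add: power2_eq_square permutes_inverses[OF l])
  qed
  also have "\<dots> = (fact (card J))\<^sup>2 * (\<Prod>j\<in>J. \<Sum>s\<in>I. (a j s)\<^sup>2)"
    using card_permutations[OF refl assms(1)] by (simp add: power2_eq_square)
  finally show ?thesis .
qed

section \<open>Convolutions\<close>

context measurable_abelian_semigroup
begin

definition conv_measure :: "'a measure \<Rightarrow> 'a measure \<Rightarrow> 'a measure" where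
  "conv_measure P Q = distr (P \<Otimes>\<^sub>M Q) M (\<lambda>(x, y). x + y)"

text \<open>The set inside \<open>conv\<close>, named so that integrands appear as functions of the
  translation \<open>x\<close>.\<close>

definition translate_vimage :: "'a set \<Rightarrow> 'a \<Rightarrow> 'a set" where
  "translate_vimage A x = {y \<in> space M. x + y \<in> A}"

lemma sets_conv_measure [simp]: "sets (conv_measure P Q) = sets M"
  by (simp add: conv_measure_def)

lemma measurable_add' [measurable (raw)]:
  "f \<in> measurable L M \<Longrightarrow> g \<in> measurable L M \<Longrightarrow> (\<lambda>x. f x + g x) \<in> measurable L M"
  using measurable_compose[OF measurable_Pair measurable_add, of f L g] by simp

lemma translate_vimage_sets [simp]: "A \<in> sets M \<Longrightarrow> translate_vimage A x \<in> sets M"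
proof -
  assume A: "A \<in> sets M"
  have "(\<lambda>y. x + y) \<in> measurable M M" by (rule measurable_add') (simp_all add: space_UNIV)
  from measurable_sets[OF this A] show ?thesis
    by (simp add: translate_vimage_def space_UNIV vimage_def)
qed

lemma translate_vimage_0 [simp]: "translate_vimage A 0 = A"
  by (simp add: translate_vimage_def space_UNIV)

lemma measurable_add_pair:
  assumes "sets P = sets M" "sets Q = sets M"
  shows "(\<lambda>(x, y). x + y) \<in> measurable (P \<Otimes>\<^sub>M Q) M"
  using measurable_add assms by (simp cong: measurable_cong_sets sets_pair_measure_cong)

lemma prob_space_conv_measure:
  assumes P: "prob_space P" "sets P = sets M" and Q: "prob_space Q" "sets Q = sets M"
  shows "prob_space (conv_measure P Q)"
proof -
  interpret P: prob_space P by fact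
  interpret Q: prob_space Q by fact
  interpret PQ: pair_prob_space P Q ..
  show ?thesis
    unfolding conv_measure_def by (rule PQ.prob_space_distr[OF measurable_add_pair[OF P(2) Q(2)]])
qed

lemma nn_integral_conv_measure:
  assumes P: "prob_space P" "sets P = sets M" and Q: "prob_space Q" "sets Q = sets M"
    and f: "f \<in> borel_measurable M"
  shows "(\<integral>\<^sup>+z. f z \<partial>conv_measure P Q) = (\<integral>\<^sup>+x. \<integral>\<^sup>+y. f (x + y) \<partial>Q \<partial>P)"
proof -
  interpret Q: prob_space Q by fact
  note m = measurable_add_pair[OF P(2) Q(2)]
  have "(\<integral>\<^sup>+z. f z \<partial>conv_measure P Q) = (\<integral>\<^sup>+z. f (case z of (x, y) \<Rightarrow> x + y) \<partial>(P \<Otimes>\<^sub>M Q))"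
    unfolding conv_measure_def using f by (subst nn_integral_distr[OF m]) auto
  also have "\<dots> = (\<integral>\<^sup>+x. \<integral>\<^sup>+y. f (x + y) \<partial>Q \<partial>P)"
    using Q.nn_integral_fst[OF measurable_compose[OF m f]] by simp
  finally show ?thesis .
qed

lemma emeasure_conv_measure:
  assumes P: "prob_space P" "sets P = sets M" and Q: "prob_space Q" "sets Q = sets M"
    and A: "A \<in> sets M"
  shows "emeasure (conv_measure P Q) A = (\<integral>\<^sup>+x. emeasure Q (translate_vimage A x) \<partial>P)"
proof -
  have "emeasure (conv_measure P Q) A = (\<integral>\<^sup>+z. indicator A z \<partial>conv_measure P Q)"
    using A by simp
  also have "\<dots> = (\<integral>\<^sup>+x. \<integral>\<^sup>+y. indicator A (x + y) \<partial>Q \<partial>P)"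
    using A by (intro nn_integral_conv_measure P Q) auto
  also have "\<dots> = (\<integral>\<^sup>+x. emeasure Q (translate_vimage A x) \<partial>P)"
  proof (rule nn_integral_cong)
    fix x
    have "(\<integral>\<^sup>+y. indicator A (x + y) \<partial>Q) = (\<integral>\<^sup>+y. indicator (translate_vimage A x) y \<partial>Q)"
      by (intro nn_integral_cong) (auto simp: translate_vimage_def space_UNIV indicator_def)
    then show "(\<integral>\<^sup>+y. indicator A (x + y) \<partial>Q) = emeasure Q (translate_vimage A x)"
      using A Q(2) by simp
  qed
  finally show ?thesis .
qed

text \<open>The translate is the section at \<open>x\<close> of the preimage of \<open>A\<close>
  under addition, so measurability of section measures applies.\<close>

lemma measurable_measure_translate:
  assumes Q: "prob_space Q" "sets Q = sets M" and A: "A \<in> sets M"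
  shows "(\<lambda>x. measure Q (translate_vimage A x)) \<in> borel_measurable M"
proof -
  interpret Q: prob_space Q by fact
  have "(\<lambda>(x, y). x + y) -` A \<inter> space (M \<Otimes>\<^sub>M Q) \<in> sets (M \<Otimes>\<^sub>M Q)"
    by (rule measurable_sets[OF measurable_add_pair[OF refl Q(2)] A])
  then have "(\<lambda>x. emeasure Q (Pair x -` ((\<lambda>(x, y). x + y) -` A \<inter> space (M \<Otimes>\<^sub>M Q)))) \<in> borel_measurable M"
    by (rule Q.measurable_emeasure_Pair)
  moreover have "Pair x -` ((\<lambda>(x, y). x + y) -` A \<inter> space (M \<Otimes>\<^sub>M Q)) = translate_vimage A x" for x
    using sets_eq_imp_space_eq[OF Q(2)]
    by (auto simp: translate_vimage_def space_UNIV space_pair_measure)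
  ultimately have "(\<lambda>x. emeasure Q (translate_vimage A x)) \<in> borel_measurable M" by simp
  then show ?thesis unfolding measure_def by (rule borel_measurable_enn2real)
qed

lemma measure_conv_measure:
  assumes P: "prob_space P" "sets P = sets M" and Q: "prob_space Q" "sets Q = sets M"
    and A: "A \<in> sets M"
  shows "measure (conv_measure P Q) A = (LINT x|P. measure Q (translate_vimage A x))"
proof -
  interpret P: prob_space P by fact
  interpret Q: prob_space Q by fact
  have "(\<lambda>x. measure Q (translate_vimage A x)) \<in> borel_measurable P"
    using measurable_measure_translate[OF Q A] P(2) by (simp cong: measurable_cong_sets)
  then have "integrable P (\<lambda>x. measure Q (translate_vimage A x))"
    by (intro P.integrable_const_bound[where B = 1]) auto
  then have "(\<integral>\<^sup>+x. emeasure Q (translate_vimage A x) \<partial>P)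
      = ennreal (LINT x|P. measure Q (translate_vimage A x))"
    unfolding Q.emeasure_eq_measure by (intro nn_integral_eq_integral) auto
  then show ?thesis
    unfolding measure_def[of "conv_measure P Q"] emeasure_conv_measure[OF P Q A] by simp
qed

lemma conv_measure_commute:
  assumes P: "prob_space P" "sets P = sets M" and Q: "prob_space Q" "sets Q = sets M"
  shows "conv_measure P Q = conv_measure Q P"
proof -
  interpret P: prob_space P by fact
  interpret Q: prob_space Q by fact
  interpret PQ: pair_prob_space P Q ..
  have "conv_measure P Q = distr (distr (Q \<Otimes>\<^sub>M P) (P \<Otimes>\<^sub>M Q) (\<lambda>(x, y). (y, x))) M (\<lambda>(x, y). x + y)"
    unfolding conv_measure_def by (subst PQ.distr_pair_swap) simp
  also have "\<dots> = distr (Q \<Otimes>\<^sub>M P) M (\<lambda>(x, y). x + y)"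
    using measurable_add_pair[OF P(2) Q(2)]
    by (subst distr_distr) (auto simp: o_def split_beta' add.commute)
  finally show ?thesis by (simp add: conv_measure_def)
qed

text \<open>On a set \<open>A\<close>, both sides are the iterated integral over \<open>x\<close>
  and \<open>y\<close> of the mass that \<open>R\<close> gives to the translate of \<open>A\<close>
  by \<open>x + y\<close>.\<close>

lemma conv_measure_assoc:
  assumes P: "prob_space P" "sets P = sets M" and Q: "prob_space Q" "sets Q = sets M"
    and R: "prob_space R" "sets R = sets M"
  shows "conv_measure (conv_measure P Q) R = conv_measure P (conv_measure Q R)"
proof (rule measure_eqI)
  fix A assume "A \<in> sets (conv_measure (conv_measure P Q) R)"
  then have A: "A \<in> sets M" by simp
  interpret R: prob_space R by fact
  have mR: "(\<lambda>x. emeasure R (translate_vimage A x)) \<in> borel_measurable M"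
    unfolding R.emeasure_eq_measure
    using measurable_measure_translate[OF R A] by measurable
  have "emeasure (conv_measure (conv_measure P Q) R) A
      = (\<integral>\<^sup>+x. emeasure R (translate_vimage A x) \<partial>conv_measure P Q)"
    using P Q R A by (simp add: emeasure_conv_measure prob_space_conv_measure)
  also have "\<dots> = (\<integral>\<^sup>+x. \<integral>\<^sup>+y. emeasure R (translate_vimage A (x + y)) \<partial>Q \<partial>P)"
    by (rule nn_integral_conv_measure[OF P Q mR])
  also have "\<dots> = (\<integral>\<^sup>+x. emeasure (conv_measure Q R) (translate_vimage A x) \<partial>P)"
  proof (rule nn_integral_cong)
    fix x
    have "translate_vimage (translate_vimage A x) y = translate_vimage A (x + y)" for y
      by (auto simp: translate_vimage_def space_UNIV add.assoc)
    then show "(\<integral>\<^sup>+y. emeasure R (translate_vimage A (x + y)) \<partial>Q)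
        = emeasure (conv_measure Q R) (translate_vimage A x)"
      using emeasure_conv_measure[OF Q R translate_vimage_sets[OF A]] by simp
  qed
  also have "\<dots> = emeasure (conv_measure P (conv_measure Q R)) A"
    using P Q R A by (simp add: emeasure_conv_measure prob_space_conv_measure)
  finally show "emeasure (conv_measure (conv_measure P Q) R) A
      = emeasure (conv_measure P (conv_measure Q R)) A" .
qed simp

lemma conv_measure_return_0:
  assumes P: "prob_space P" "sets P = sets M"
  shows "conv_measure (return M 0) P = P"
proof (rule measure_eqI)
  fix A assume "A \<in> sets (conv_measure (return M 0) P)"
  then have A: "A \<in> sets M" by simp
  interpret P: prob_space P by fact
  have "(\<lambda>x. emeasure P (translate_vimage A x)) \<in> borel_measurable M"
    unfolding P.emeasure_eq_measure
    using measurable_measure_translate[OF P A] by measurable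
  moreover have "emeasure (conv_measure (return M 0) P) A
      = (\<integral>\<^sup>+x. emeasure P (translate_vimage A x) \<partial>return M 0)"
    using P A by (intro emeasure_conv_measure) (auto intro: prob_space_return simp: space_UNIV)
  ultimately show "emeasure (conv_measure (return M 0) P) A = emeasure P A"
    by (simp add: nn_integral_return space_UNIV)
qed (simp add: P)

end

section \<open>Convolutions indexed by multisets\<close>

locale compound_poisson = measurable_abelian_semigroup M + multi_poisson I lam
  for M :: "'a::comm_monoid_add measure" and I :: "'i set" and lam +
  fixes U :: "'i \<Rightarrow> 'a measure"
  assumes prob_U: "r \<in> I \<Longrightarrow> prob_space (U r)" and sets_U: "r \<in> I \<Longrightarrow> sets (U r) = sets M"
begin

definition conv_list :: "'i list \<Rightarrow> 'a measure" where
  "conv_list w = foldr (\<lambda>r. conv_measure (U r)) w (return M 0)"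

text \<open>The value outside \<open>msets\<close> is a dummy; it only has to be a probability measure on \<open>M\<close>.\<close>

definition conv_mset :: "'i multiset \<Rightarrow> 'a measure" where
  "conv_mset n = (if n \<in> msets then conv_list (SOME w. mset w = n) else return M 0)"

lemma prob_return_0: "prob_space (return M 0)"
  by (rule prob_space_return) (simp add: space_UNIV)

lemma conv_list_props:
  "set w \<subseteq> I \<Longrightarrow> prob_space (conv_list w) \<and> sets (conv_list w) = sets M"
  by (induction w) (auto simp: conv_list_def prob_return_0 prob_U sets_U intro!: prob_space_conv_measure)

lemma conv_measure_left_commute:
  assumes P: "prob_space P" "sets P = sets M" and Q: "prob_space Q" "sets Q = sets M"
    and R: "prob_space R" "sets R = sets M"
  shows "conv_measure P (conv_measure Q R) = conv_measure Q (conv_measure P R)"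
  using conv_measure_assoc[OF P Q R] conv_measure_assoc[OF Q P R] conv_measure_commute[OF P Q] by simp

lemma conv_list_move:
  "set v \<subseteq> I \<Longrightarrow> r \<in> I \<Longrightarrow> set w \<subseteq> I \<Longrightarrow>
    conv_list (v @ r # w) = conv_measure (U r) (conv_list (v @ w))"
proof (induction v)
  case Nil
  then show ?case by (simp add: conv_list_def)
next
  case (Cons s v)
  have "conv_list ((s # v) @ r # w) = conv_measure (U s) (conv_list (v @ r # w))"
    by (simp add: conv_list_def)
  also have "\<dots> = conv_measure (U s) (conv_measure (U r) (conv_list (v @ w)))"
    using Cons by simp
  also have "\<dots> = conv_measure (U r) (conv_measure (U s) (conv_list (v @ w)))"
    using Cons.prems conv_list_props[of "v @ w"]
    by (intro conv_measure_left_commute) (auto simp: prob_U sets_U)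
  finally show ?case by (simp add: conv_list_def)
qed

text \<open>The head of \<open>v\<close> occurs somewhere in \<open>w\<close> and can be moved to
  its front. Hence the choice of a word in \<open>conv_mset\<close> is immaterial.\<close>

lemma conv_list_cong_mset:
  "mset v = mset w \<Longrightarrow> set v \<subseteq> I \<Longrightarrow> conv_list v = conv_list w"
proof (induction v arbitrary: w)
  case Nil
  then show ?case by simp
next
  case (Cons r v)
  then have "r \<in> set w" by (metis list.set_intros(1) mset_eq_setD)
  then obtain w1 w2 where w: "w = w1 @ r # w2" by (meson split_list)
  have sw: "set w \<subseteq> I" using Cons.prems by (metis mset_eq_setD)
  have "conv_list v = conv_list (w1 @ w2)"
    using Cons.prems w by (intro Cons.IH) auto
  then show ?case
    using conv_list_move[of w1 r w2] sw w by (simp add: conv_list_def)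
qed

lemma conv_mset_mset: "set w \<subseteq> I \<Longrightarrow> conv_mset (mset w) = conv_list w"
proof -
  assume w: "set w \<subseteq> I"
  have *: "mset w = mset (SOME v. mset v = mset w)" 
    using someI[of "\<lambda>v. mset v = mset w" w, OF refl] by simp
  show ?thesis
    using w unfolding conv_mset_def conv_list_cong_mset[OF * w] by (simp add: msets_def)
qed

lemma conv_mset_empty: "conv_mset {#} = return M 0"
  using conv_mset_mset[of "[]"] by (simp add: conv_list_def)

lemma conv_mset_add_mset:
  assumes "r \<in> I" "n \<in> msets"
  shows "conv_mset (add_mset r n) = conv_measure (U r) (conv_mset n)"
proof -
  obtain w where w: "mset w = n" using ex_mset by blast
  then have "set w \<subseteq> I" using assms(2) by (auto simp: msets_def)
  then show ?thesis
    using conv_mset_mset[of w] conv_mset_mset[of "r # w"] assms(1) w by (simp add: conv_list_def)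
qed

lemma conv_mset_props: "prob_space (conv_mset n)" "sets (conv_mset n) = sets M"
proof -
  have "prob_space (conv_mset n) \<and> sets (conv_mset n) = sets M"
  proof (cases "n \<in> msets")
    case True
    obtain w where w: "mset w = n" using ex_mset by blast
    then have "set w \<subseteq> I" using True by (auto simp: msets_def)
    then show ?thesis using conv_mset_mset conv_list_props w by metis
  qed (simp add: conv_mset_def prob_return_0)
  then show "prob_space (conv_mset n)" "sets (conv_mset n) = sets M" by auto
qed

lemma conv_mset_plus:
  "m \<in> msets \<Longrightarrow> n \<in> msets \<Longrightarrow> conv_mset (m + n) = conv_measure (conv_mset m) (conv_mset n)"
proof (induction m)
  case empty
  then show ?case by (simp add: conv_mset_empty conv_measure_return_0 conv_mset_props)
next
  case (add r m)
  then have "r \<in> I" "m \<in> msets" "m + n \<in> msets" by (auto simp: msets_def)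
  then show ?case
    using add by (simp add: conv_mset_add_mset conv_measure_assoc conv_mset_props prob_U sets_U)
qed

section \<open>Signed convolutions as difference operators\<close>

abbreviation mu :: "'a set \<Rightarrow> 'i multiset \<Rightarrow> real" where
  "mu A n \<equiv> measure (conv_mset n) A"

text \<open>Both the factors of the product and the exponent of \<open>G\<close> have this
  form.\<close>

definition signed_sum :: "('i \<Rightarrow> real) \<Rightarrow> 'a set \<Rightarrow> real" where
  "signed_sum p A = (\<Sum>r\<in>I. p r * (measure (U r) A - dirac M 0 A))"

lemma mu_le_1: "\<bar>mu A n\<bar> \<le> 1"
  using prob_space.prob_le_1[OF conv_mset_props(1), of n A] by simp

lemma measurable_mu_translate:
  "A \<in> sets M \<Longrightarrow> (\<lambda>x. mu (translate_vimage A x) n) \<in> borel_measurable M"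
  by (intro measurable_measure_translate conv_mset_props)

text \<open>Integrating the translates against \<open>conv_mset k\<close> adds \<open>k\<close> to
  the multiset argument. Differences commute with this integral and with the shift, so the
  evaluation point moves from \<open>{#}\<close> to \<open>k\<close>.\<close>

lemma fold_diff_op_translate:
  assumes A: "A \<in> sets M" and k: "k \<in> msets"
  shows "(LINT x|conv_mset k. fold diff_op us (mu (translate_vimage A x)) {#}) = fold diff_op us (mu A) k"
proof -
  have "integrable (conv_mset k) (\<lambda>x. mu (translate_vimage A x) m)" for m
    using conv_mset_props prob_space.finite_measure
    by (intro integrable_bounded[where M = M and C = 1] measurable_mu_translate A mu_le_1) auto
  then have "(LINT x|conv_mset k. fold diff_op us (mu (translate_vimage A x)) {#})
      = fold diff_op us (\<lambda>m. LINT x|conv_mset k. mu (translate_vimage A x) m) {#}"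
    by (rule fold_diff_op_integral[symmetric])
  also have "\<dots> = fold diff_op us (\<lambda>m. mu A (m + k)) {#}"
  \<comment> \<open>The product rule \<open>conv_mset_plus\<close> is available on
    \<open>msets\<close>, and the comparison is made only there.\<close>
  proof (rule fold_diff_op_cong)
    fix m assume "m \<in> msets"
    then show "(LINT x|conv_mset k. mu (translate_vimage A x) m) = mu A (m + k)"
      using k A conv_mset_plus[of k m]
      by (simp add: measure_conv_measure conv_mset_props add.commute[of m])
  qed simp
  also have "\<dots> = fold diff_op us (mu A) k"
    using fold_diff_op_shift[of us "mu A" k "{#}"] by simp
  finally show ?thesis .
qed

lemma signed_integral_signed_sum:
  assumes f: "f \<in> borel_measurable M" "\<And>x. \<bar>f x\<bar> \<le> C"
  shows "signed_integral M (signed_sum p) f = (\<Sum>r\<in>I. p r * ((LINT x|U r. f x) - f 0))"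
proof -
  \<comment> \<open>The Boolean separates the two probability measures in each summand, with weights
    \<open>p r\<close> and \<open>- p r\<close>.\<close>
  define \<kappa> where "\<kappa> = (\<lambda>(r, b). if b then U r else return M 0)"
  define c where "c = (\<lambda>(r, b). if b then p r else - p r)"
  have fin: "finite (I \<times> (UNIV :: bool set))" using finite_I by simp
  have "signed_integral M (signed_sum p) f = (\<Sum>\<^sub>\<infinity>j\<in>I \<times> UNIV. c j * (LINT x|\<kappa> j. f x))"
  proof (rule signed_integral_mixture[OF _ _ _ _ f])
    fix A assume "A \<in> sets M"
    show "signed_sum p A = (\<Sum>\<^sub>\<infinity>j\<in>I \<times> UNIV. c j * measure (\<kappa> j) A)"
      using fin by (simp add: sum.cartesian_product' UNIV_bool c_def \<kappa>_def signed_sum_def dirac_def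
          algebra_simps)
  next
    fix j assume "j \<in> I \<times> (UNIV :: bool set)"
    then show "prob_space (\<kappa> j)" "sets (\<kappa> j) = sets M"
      by (cases j; simp add: \<kappa>_def prob_U sets_U prob_return_0)+
  qed (use fin in simp)
  also have "\<dots> = (\<Sum>r\<in>I. p r * ((LINT x|U r. f x) - f 0))"
    using fin f by (simp add: sum.cartesian_product' UNIV_bool c_def \<kappa>_def integral_return space_UNIV
        algebra_simps)
  finally show ?thesis .
qed

text \<open>Convolving with one more factor integrates a translated difference expression against
  it, which is one more difference evaluated at \<open>{#}\<close>.\<close>

lemma conv_prod_eq_diff_op:
  "A \<in> sets M \<Longrightarrow> conv_prod M (\<lambda>j. signed_sum (p j)) k A
    = fold diff_op (map p [1..<Suc k]) (mu A) {#}"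
proof (induction k arbitrary: A)
  case 0
  then show ?case by (simp add: conv_mset_empty dirac_def)
next
  case (Suc k)
  define us where "us = map p [1..<Suc k]"
  define f where "f x = fold diff_op us (mu (translate_vimage A x)) {#}" for x
  have f: "f \<in> borel_measurable M"
    unfolding f_def by (intro measurable_fold_diff_op measurable_mu_translate Suc.prems)
  obtain C where C: "\<And>x. \<bar>f x\<bar> \<le> C"
    using fold_diff_op_bounded[of "\<lambda>x. mu (translate_vimage A x)" 1 us] mu_le_1
    unfolding f_def by blast
  have U: "conv_mset {#r#} = U r" if "r \<in> I" for r
    using conv_mset_mset[of "[r]"] that conv_measure_commute[of "U r" "return M 0"]
    by (simp add: conv_list_def conv_measure_return_0 prob_U sets_U prob_return_0)
  have "conv_prod M (\<lambda>j. signed_sum (p j)) (Suc k) A = signed_integral M (signed_sum (p (Suc k))) f"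
    unfolding f_def[abs_def] us_def
    by (simp add: conv_def Suc translate_vimage_def[symmetric] del: upt_Suc)
  \<comment> \<open>Integration against \<open>U r\<close> moves the evaluation point to
    \<open>{#r#}\<close>; the point mass at \<open>0\<close> leaves it at
    \<open>{#}\<close>.\<close>
  also have "\<dots> = (\<Sum>r\<in>I. p (Suc k) r * (fold diff_op us (mu A) {#r#} - fold diff_op us (mu A) {#}))"
    unfolding signed_integral_signed_sum[OF f C]
    using fold_diff_op_translate[OF Suc.prems, of "{#r#}" us for r]
    by (intro sum.cong) (auto simp: f_def[abs_def] U msets_def)
  also have "\<dots> = fold diff_op (map p [1..<Suc (Suc k)]) (mu A) {#}"
  proof -
    have "map p [1..<Suc (Suc k)] = us @ [p (Suc k)]" by (simp add: us_def)
    then show ?thesis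
      by (simp only: fold_append fold_simps o_apply diff_op_def)
  qed
  finally show ?case .
qed

text \<open>The powers are iterates of \<open>diff_op lam\<close> at \<open>{#}\<close>, and
  \<open>diff_op_exp_sums\<close> sums their series. Thus \<open>G\<close> is a compound Poisson
  law: the mixture of the \<open>conv_mset n\<close> with Poisson weights.\<close>

lemma conv_exp_eq_expct:
  assumes "A \<in> sets M"
  shows "conv_exp M (signed_sum lam) A = expct (mu A)"
proof -
  have "conv_power M (signed_sum lam) m A = (diff_op lam ^^ m) (mu A) {#}" for m
  proof -
    have "fold diff_op (map (\<lambda>_. lam) [1..<Suc m]) g = (diff_op lam ^^ m) g" for g
      by (induction m) auto
    then show ?thesis
      using conv_prod_eq_diff_op[OF assms, of "\<lambda>_. lam" m] by (simp add: conv_power_def)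
  qed
  then show ?thesis
    using diff_op_exp_sums[of "mu A" 1, OF mu_le_1] by (simp add: conv_exp_def sums_iff)
qed

lemma tv_norm_conv_prod_le:
  "tv_norm M (conv M (conv_prod M (\<lambda>j. signed_sum (p j)) k) (conv_exp M (signed_sum lam)))
    \<le> sqrt (expct (\<lambda>n. (charlier (map p [1..<Suc k]) n)\<^sup>2))"
proof -
  define us where "us = map p [1..<Suc k]"
  define c where "c n = exp (- sum lam I) * weight n" for n
  have expct_eq: "expct g = (\<Sum>\<^sub>\<infinity>n\<in>msets. c n * g n)" for g
    by (simp add: expct_def c_def infsum_cmult_right' mult.assoc)
  have summable: "(\<lambda>n. c n * g n) summable_on msets" if "exp_growth g" for g
    using summable_on_cmult_right[OF summable_exp_growth[OF that], of "exp (- sum lam I)"]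
    by (simp add: c_def mult.assoc)
  have c: "c summable_on msets" using summable[OF exp_growth_const[of 1]] by simp
  have c_ge_0: "c n \<ge> 0" for n by (simp add: c_def weight_nonneg)
  have eq: "conv M (conv_prod M (\<lambda>j. signed_sum (p j)) k) (conv_exp M (signed_sum lam)) A
      = (\<Sum>\<^sub>\<infinity>n\<in>msets. (c n * charlier us n) * mu A n)" if A: "A \<in> sets M" for A
  proof -
    define f where "f x = fold diff_op us (mu (translate_vimage A x)) {#}" for x
    have f: "f \<in> borel_measurable M"
      unfolding f_def by (intro measurable_fold_diff_op measurable_mu_translate A)
    obtain C where C: "\<And>x. \<bar>f x\<bar> \<le> C"
      using fold_diff_op_bounded[of "\<lambda>x. mu (translate_vimage A x)" 1 us] mu_le_1
      unfolding f_def by blast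
    have "conv M (conv_prod M (\<lambda>j. signed_sum (p j)) k) (conv_exp M (signed_sum lam)) A
        = signed_integral M (conv_exp M (signed_sum lam)) f"
      using A by (simp add: conv_def f_def[abs_def] us_def conv_prod_eq_diff_op
          translate_vimage_def[symmetric])
    \<comment> \<open>The Poisson mixture for \<open>G\<close> replaces the signed integral, after
      which each integral of \<open>f\<close> is a difference expression at
      \<open>n\<close>.\<close>
    also have "\<dots> = (\<Sum>\<^sub>\<infinity>n\<in>msets. c n * (LINT x|conv_mset n. f x))"
      by (rule signed_integral_mixture[OF c conv_mset_props _ f C])
        (simp add: conv_exp_eq_expct expct_eq)
    also have "\<dots> = expct (fold diff_op us (mu A))"
      unfolding expct_eq using A by (intro infsum_cong) (simp add: f_def fold_diff_op_translate)
    \<comment> \<open>Adjointness transfers the differences from \<open>mu A\<close> to coefficients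
      independent of \<open>A\<close>, which exhibits a signed mixture.\<close>
    also have "\<dots> = expct (\<lambda>n. charlier us n * mu A n)"
      by (rule expct_charlier_eq_diff_op[symmetric]) (rule exp_growth_bounded[OF mu_le_1])
    finally show ?thesis by (simp add: expct_eq mult.assoc)
  qed
  have "tv_norm M (conv M (conv_prod M (\<lambda>j. signed_sum (p j)) k) (conv_exp M (signed_sum lam)))
      \<le> (\<Sum>\<^sub>\<infinity>n\<in>msets. \<bar>c n * charlier us n\<bar>)"
    by (rule tv_norm_mixture_le[OF summable[OF exp_growth_charlier] conv_mset_props eq])
  also have "\<dots> = expct (\<lambda>n. \<bar>charlier us n\<bar>)"
    by (simp add: expct_eq abs_mult c_ge_0)
  also have "\<dots> \<le> sqrt (expct (\<lambda>n. (charlier us n)\<^sup>2))"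
    by (rule expct_abs_le_sqrt[OF exp_growth_charlier])
  finally show ?thesis by (simp only: us_def)
qed

end

section \<open>The permanent bound for the norm and its product estimate\<close>

theorem lemma4p1:
  fixes M :: "'a::comm_monoid_add measure"
    and d k :: nat
    and p :: "nat \<Rightarrow> nat \<Rightarrow> real"
    and lam :: "nat \<Rightarrow> real"
    and U :: "nat \<Rightarrow> 'a measure"
    and W R :: "nat \<Rightarrow> 'a set \<Rightarrow> real"
    and G :: "'a set \<Rightarrow> real"
  assumes "measurable_abelian_semigroup M"
    and "\<And>r. r \<in> {1..d} \<Longrightarrow> lam r > 0"
    and "\<And>r. r \<in> {1..d} \<Longrightarrow> prob_space (U r)"
    and "\<And>r. r \<in> {1..d} \<Longrightarrow> sets (U r) = sets M"
    and "W = (\<lambda>r A. measure (U r) A - dirac M 0 A)"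
    and "R = (\<lambda>j A. \<Sum>r=1..d. p j r * W r A)"
    and "G = conv_exp M (\<lambda>A. \<Sum>r=1..d. lam r * W r A)"
  shows "tv_norm M (conv M (conv_prod M R k) G)
      \<le> sqrt (1 / fact k * (\<Sum>r\<in>{1..k} \<rightarrow>\<^sub>E {1..d}.
            (\<Sum>l | l permutes {1..k}. \<Prod>j=1..k. p j (r (l j)) / sqrt (lam (r (l j))))\<^sup>2))
    \<and> sqrt (1 / fact k * (\<Sum>r\<in>{1..k} \<rightarrow>\<^sub>E {1..d}.
            (\<Sum>l | l permutes {1..k}. \<Prod>j=1..k. p j (r (l j)) / sqrt (lam (r (l j))))\<^sup>2))
      \<le> sqrt (fact k) * (\<Prod>j=1..k. sqrt (\<Sum>r=1..d. (p j r)\<^sup>2 / lam r))"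
proof -
  interpret measurable_abelian_semigroup M by fact
  interpret compound_poisson M "{1..d}" lam U
    using assms(1-4)
    by (intro compound_poisson.intro compound_poisson_axioms.intro multi_poisson.intro) auto
  \<comment> \<open>Splitting \<open>1 / lam r\<close> evenly between two factors makes
    \<open>inner_lam\<close> an ordinary inner product of the rows of \<open>a\<close>.\<close>
  define a where "a j r = p j r / sqrt (lam r)" for j r
  define S where "S = (\<Sum>r\<in>{1..k} \<rightarrow>\<^sub>E {1..d}.
    (\<Sum>l | l permutes {1..k}. \<Prod>j=1..k. a j (r (l j)))\<^sup>2)"
  have a: "(\<Sum>r=1..d. a i r * a j r) = inner_lam (p i) (p j)" for i j
    unfolding inner_lam_def
  proof (rule sum.cong[OF refl])
    fix r assume "r \<in> {1..d}"
    then have "sqrt (lam r) * sqrt (lam r) = lam r" using lam_pos[of r] by simp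
    then show "a i r * a j r = p i r * p j r / lam r" by (simp add: a_def)
  qed
  have a2: "(\<Sum>r=1..d. (a j r)\<^sup>2) = (\<Sum>r=1..d. (p j r)\<^sup>2 / lam r)" for j
    unfolding power2_eq_square using a[of j j] unfolding inner_lam_def .
  have set: "set [1..<Suc k] = {1..k}" by auto
  have R: "R = (\<lambda>j. signed_sum (p j))" and G: "G = conv_exp M (signed_sum lam)"
    unfolding assms(5-7) signed_sum_def[abs_def] by (rule refl)+
  have "tv_norm M (conv M (conv_prod M R k) G) \<le> sqrt (expct (\<lambda>n. (charlier (map p [1..<Suc k]) n)\<^sup>2))"
    unfolding R G by (rule tv_norm_conv_prod_le)
  \<comment> \<open>The second moment is the Gram permanent, and the sum \<open>S\<close> of squared
    permanents is \<open>fact k\<close> times it.\<close>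
  also have "expct (\<lambda>n. (charlier (map p [1..<Suc k]) n)\<^sup>2) = 1 / fact k * S"
  proof -
    have "expct (\<lambda>n. (charlier (map p [1..<Suc k]) n)\<^sup>2)
        = (\<Sum>l | l permutes {1..k}. \<Prod>j=1..k. inner_lam (p j) (p (l j)))"
      using expct_charlier_square[of "[1..<Suc k]" p] unfolding set by simp
    moreover have "S = fact k * (\<Sum>l | l permutes {1..k}. \<Prod>j=1..k. inner_lam (p j) (p (l j)))"
      unfolding S_def a[symmetric] using sum_PiE_permanent_square[of "{1..k}" "{1..d}" a] by simp
    ultimately show ?thesis by simp
  qed
  finally have "tv_norm M (conv M (conv_prod M R k) G) \<le> sqrt (1 / fact k * S)" .
  moreover have "sqrt (1 / fact k * S) \<le> sqrt (fact k) * (\<Prod>j=1..k. sqrt (\<Sum>r=1..d. (p j r)\<^sup>2 / lam r))"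
  proof -
    \<comment> \<open>One of the two factorials cancels against \<open>1 / fact k\<close>; the other
      becomes \<open>sqrt (fact k)\<close>.\<close>
    have "1 / fact k * S \<le> 1 / fact k * ((fact k)\<^sup>2 * (\<Prod>j=1..k. \<Sum>r=1..d. (p j r)\<^sup>2 / lam r))"
      using sum_PiE_permanent_square_le[of "{1..k}" "{1..d}" a]
      unfolding S_def a2[symmetric] by (intro mult_left_mono) simp_all
    also have "\<dots> = fact k * (\<Prod>j=1..k. \<Sum>r=1..d. (p j r)\<^sup>2 / lam r)"
      by (simp add: power2_eq_square)
    finally have "sqrt (1 / fact k * S) \<le> sqrt (fact k * (\<Prod>j=1..k. \<Sum>r=1..d. (p j r)\<^sup>2 / lam r))"
      by (rule real_sqrt_le_mono)
    moreover have "sqrt (prod f J) = (\<Prod>j\<in>J. sqrt (f j))" for f :: "nat \<Rightarrow> real" and J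
      by (induction J rule: infinite_finite_induct) (simp_all add: real_sqrt_mult)
    ultimately show ?thesis by (simp add: real_sqrt_mult)
  qed
  ultimately show ?thesis unfolding S_def a_def by (rule conjI)
qed

end
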